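(* There exist positive absolute constants $C_1,C_2$ such that the following holds. Let $N\ge 1$, $d_n\ge 0$, $d_s\ge 1$ be integers (so that $d_*:=d_n+d_s>0$), let $\alpha\in(0,1/2)$, let $\overline{\mathbf w}\in\Omega_{d_n}$, and let $\rho>0$ satisfy $$\rho\;\ge\; C_1\, d_*^3\ln(2d_* )\,q_N(\alpha)\,N^{-1/2},$$ or satisfy the condition (equivalent up to the choice of absolute constant) $$\rho\;\ge\; C_2\, d_*^3\ln(2d_* )\sqrt{N^{-1}\ln(N/\alpha)} .$$ Then the basic test $\widehat\varphi$ with tolerance $\alpha$, as applied to problem $(P_2)$ (and, when $d_n=0$, to problem $(P_1)$), satisfies $\mathrm{Risk}(\widehat\varphi,\rho)\le\alpha$.
   Context: Signals. $\mathcal S$ is the space of two-sided real sequences $z=\{z_t\}_{t\in\mathbf Z}$; for $z\in\mathcal S$ and integers $p\le q$, $z_p^q=[z_p;z_{p+1};\ldots;z_q]$. $\Delta$ is the shift on $\mathcal S$: $(\Delta z)_t=z_{t-1}$. For an integer $d\ge1$, $\Omega_d$ is the set of unordered collections (multisets) $\mathbf w=\{\omega_1,\ldots,\omega_d\}$ of $d$ reals that are symmetric mod $2\pi$: for every real $a$, the number of $i$ with $\omega_i\equiv a \pmod{2\pi}$ equals the number of $i$ with $\omega_i\equiv -a\pmod{2\pi}$. For $\mathbf w\in\Omega_d$, $p_{\mathbf w}(\zeta)=\prod_{\ell=1}^d(1-\exp\{\imath\omega_\ell\}\zeta)$ (a real polynomial), and $\mathcal S[\mathbf w]=\{x\in\mathcal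 S: p_{\mathbf w}(\Delta)x\equiv 0\}$; $\mathcal S_d=\bigcup_{\mathbf w\in\Omega_d}\mathcal S[\mathbf w]$. For $d=0$: $\Omega_0=\{\emptyset\}$, $p_\emptyset\equiv1$, so $\mathcal S[\emptyset]=\{0\}$. Observations. For $x\in\mathcal S$ one observes $y=x_0^{N-1}+\xi\in\mathbf R^N$ with $\xi\sim\mathcal N(0,I_N)$; $\mathrm{Prob}_x$ is the corresponding probability. Problem $(P_1)$: $H_0=\{x=0\}$, $H_1(\rho)=\{x\in\mathcal S_{d_s}:\|x_0^{N-1}\|_\infty\ge\rho\}$. Problem $(P_2)$ (with given $\overline{\mathbf w}\in\Omega_{d_n}$): $H_0=\mathcal S[\overline{\mathbf w}]$, and $H_1(\rho)=\{x=u+s:\ u\in\mathcal S[\overline{\mathbf w}],\ s\in\mathcal S_{d_s},\ \min_{z\in\mathcal S[\overline{\mathbf w}]}\|[x-z]_0^{N-1}\|_\infty\ge\rho\}$. Tests and risk. A test is a Borel function $\varphi:\mathbf R^N\to\{0,1\}$; $\varphi(y)=1$ means rejecting $H_0$, $\varphi(y)=0$ means rejecting $H_1(\rho)$. $\varepsilon_0(\varphi;H_0)=\sup_{x\in H_0}\mathrm{Prob}_x\{\varphi(y)=1\}$, $\varepsilon_1(\varphi;H_1(\rho))=\sup_{x\in H_1(\rho)}\mathrm{Prob}_x\{\varphi(y)=0\}$, $\mathrm{Risk}(\varphi,\rho)=\max\{\varepsilon_0(\varphi;H_0),\varepsilon_1(\varphi;H_1(\rho))\}$. Fourier transform. $\Gamma_N$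 is the set of complex $N$-th roots of unity, and $[F_Nf](\mu)=N^{-1/2}\sum_{t=0}^{N-1}f_t\mu^t$ for $\mu\in\Gamma_N$, $f\in\mathbf C^N$; $\|F_Nf\|_\infty=\max_{\mu\in\Gamma_N}|[F_Nf](\mu)|$. $q_N(\alpha)$ is the $(1-\alpha)$-quantile of $\|F_N\xi\|_\infty$, $\xi\sim\mathcal N(0,I_N)$, so that $\mathrm{Prob}\{\|F_N\xi\|_\infty\ge q_N(\alpha)\}\le\alpha$. Basic test $\widehat\varphi$ (tolerance $\alpha$). Given $y$, compute $\mathrm{Opt}_{\mathcal Z}(y)=\min_{z\in\mathcal Z}\|F_N(y-z_0^{N-1})\|_\infty$, where $\mathcal Z=\{0\}$ for $(P_1)$ and $\mathcal Z=\mathcal S[\overline{\mathbf w}]$ for $(P_2)$. If $\mathrm{Opt}_{\mathcal Z}(y)\le q_N(\alpha)$, accept $H_0$ ($\widehat\varphi(y)=0$); otherwise accept $H_1$ ($\widehat\varphi(y)=1$). *)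

theory Defs
  imports "HOL-Probability.Probability" "HOL-Computational_Algebra.Polynomial" "HOL-Library.Real_Mod"
begin

text \<open>
  Since the constants of the theorem have to be uniform in \<open>N\<close>, vectors of length \<open>N\<close> are not
  typed by their dimension: they are functions on \<open>nat\<close> of which only the values on \<open>{..<N}\<close>
  matter. As a measurable space, \<open>R^N\<close> is the product space over \<open>{..<N}\<close>, whose sigma-algebra is
  the Borel one.
\<close>

type_synonym signal = "int \<Rightarrow> real"

definition window :: "nat \<Rightarrow> signal \<Rightarrow> nat \<Rightarrow> real" where
  "window N x = (\<lambda>t\<in>{..<N}. x (int t))"

definition sup_norm :: "nat \<Rightarrow> (nat \<Rightarrow> real) \<Rightarrow> real" where
  "sup_norm N f = Max ((\<lambda>t. \<bar>f t\<bar>) ` {..<N})"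

definition shift :: "signal \<Rightarrow> signal" where
  "shift z = (\<lambda>t. z (t - 1))"

definition apply_shift_poly :: "complex poly \<Rightarrow> signal \<Rightarrow> int \<Rightarrow> complex" where
  "apply_shift_poly p x = (\<lambda>t. \<Sum>k\<le>degree p. coeff p k * complex_of_real ((shift ^^ k) x t))"

definition Freqs :: "nat \<Rightarrow> real multiset set" where
  "Freqs d = {w. size w = d \<and>
     (\<forall>a. size {#\<omega> \<in># w. [\<omega> = a] (rmod (2 * pi))#} = size {#\<omega> \<in># w. [\<omega> = - a] (rmod (2 * pi))#})}"

definition freq_poly :: "real multiset \<Rightarrow> complex poly" where
  "freq_poly w = (\<Prod>\<omega>\<in>#w. [:1, - exp (\<i> * complex_of_real \<omega>):])"

definition Sig :: "real multiset \<Rightarrow> signal set" where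
  "Sig w = {x. \<forall>t. apply_shift_poly (freq_poly w) x t = 0}"

definition Sig_dim :: "nat \<Rightarrow> signal set" where
  "Sig_dim d = (\<Union>w\<in>Freqs d. Sig w)"


definition Rvec :: "nat \<Rightarrow> (nat \<Rightarrow> real) measure" where
  "Rvec N = (\<Pi>\<^sub>M t\<in>{..<N}. borel)"

definition gauss_noise :: "nat \<Rightarrow> (nat \<Rightarrow> real) measure" where
  "gauss_noise N = (\<Pi>\<^sub>M t\<in>{..<N}. std_normal_distribution)"

definition obs_distr :: "nat \<Rightarrow> signal \<Rightarrow> (nat \<Rightarrow> real) measure" where
  "obs_distr N x = distr (gauss_noise N) (Rvec N) (\<lambda>\<xi>. \<lambda>t\<in>{..<N}. window N x t + \<xi> t)"


definition is_test :: "nat \<Rightarrow> ((nat \<Rightarrow> real) \<Rightarrow> nat) \<Rightarrow> bool" where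
  "is_test N \<phi> \<longleftrightarrow> \<phi> \<in> Rvec N \<rightarrow>\<^sub>M count_space {0, 1}"

text \<open>
  Suprema are taken in \<open>ennreal\<close>, so that the supremum over an empty alternative is \<open>0\<close>
  (for the second problem the alternative is empty when \<open>Sig w\<close> fills all of \<open>R^N\<close>).
  The risk is meaningful only for \<open>\<phi>\<close> with \<open>is_test N \<phi>\<close>, because \<open>emeasure\<close> vanishes on
  non-measurable sets.
\<close>

definition err0 :: "nat \<Rightarrow> ((nat \<Rightarrow> real) \<Rightarrow> nat) \<Rightarrow> signal set \<Rightarrow> ennreal" where
  "err0 N \<phi> H0 = (SUP x\<in>H0. emeasure (obs_distr N x) {y \<in> space (Rvec N). \<phi> y = 1})"

definition err1 :: "nat \<Rightarrow> ((nat \<Rightarrow> real) \<Rightarrow> nat) \<Rightarrow> signal set \<Rightarrow> ennreal" where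
  "err1 N \<phi> H1 = (SUP x\<in>H1. emeasure (obs_distr N x) {y \<in> space (Rvec N). \<phi> y = 0})"

definition Risk :: "nat \<Rightarrow> ((nat \<Rightarrow> real) \<Rightarrow> nat) \<Rightarrow> signal set \<Rightarrow> signal set \<Rightarrow> ennreal" where
  "Risk N \<phi> H0 H1 = max (err0 N \<phi> H0) (err1 N \<phi> H1)"


definition P1_H0 :: "signal set" where
  "P1_H0 = {\<lambda>_. 0}"

definition P1_H1 :: "nat \<Rightarrow> nat \<Rightarrow> real \<Rightarrow> signal set" where
  "P1_H1 N ds \<rho> = {x \<in> Sig_dim ds. sup_norm N (window N x) \<ge> \<rho>}"

definition P2_H0 :: "real multiset \<Rightarrow> signal set" where
  "P2_H0 w = Sig w"

text \<open>
  The minima over the nuisance signals, here and in \<open>Opt\<close> below, are written as infima; they are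
  attained, since the windows of the signals in \<open>Sig w\<close> form a linear subspace of \<open>R^N\<close>.
\<close>

definition P2_H1 :: "nat \<Rightarrow> real multiset \<Rightarrow> nat \<Rightarrow> real \<Rightarrow> signal set" where
  "P2_H1 N w ds \<rho> = {x. (\<exists>u\<in>Sig w. \<exists>s\<in>Sig_dim ds. x = (\<lambda>t. u t + s t)) \<and>
     (INF z\<in>Sig w. sup_norm N (window N (\<lambda>t. x t - z t))) \<ge> \<rho>}"


definition unity_roots :: "nat \<Rightarrow> complex set" where
  "unity_roots N = {\<mu>. \<mu> ^ N = 1}"

definition DFT :: "nat \<Rightarrow> (nat \<Rightarrow> complex) \<Rightarrow> complex \<Rightarrow> complex" where
  "DFT N f \<mu> = complex_of_real (real N powr (-1/2)) * (\<Sum>t<N. f t * \<mu> ^ t)"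

definition DFT_norm :: "nat \<Rightarrow> (nat \<Rightarrow> complex) \<Rightarrow> real" where
  "DFT_norm N f = Max ((\<lambda>\<mu>. cmod (DFT N f \<mu>)) ` unity_roots N)"

definition q_quantile :: "nat \<Rightarrow> real \<Rightarrow> real" where
  "q_quantile N \<alpha> = Inf {q. measure (gauss_noise N)
     {\<xi> \<in> space (gauss_noise N). DFT_norm N (\<lambda>t. complex_of_real (\<xi> t)) \<le> q} \<ge> 1 - \<alpha>}"


definition Opt :: "nat \<Rightarrow> signal set \<Rightarrow> (nat \<Rightarrow> real) \<Rightarrow> real" where
  "Opt N Z y = (INF z\<in>Z. DFT_norm N (\<lambda>t. complex_of_real (y t - window N z t)))"

definition basic_test :: "nat \<Rightarrow> real \<Rightarrow> signal set \<Rightarrow> (nat \<Rightarrow> real) \<Rightarrow> nat" where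
  "basic_test N \<alpha> Z y = (if Opt N Z y \<le> q_quantile N \<alpha> then 0 else 1)"


text \<open>The two resolution thresholds, up to the absolute constants.\<close>

definition rate_quantile :: "nat \<Rightarrow> nat \<Rightarrow> real \<Rightarrow> real" where
  "rate_quantile N d \<alpha> = real d ^ 3 * ln (2 * real d) * q_quantile N \<alpha> * real N powr (-1/2)"

definition rate_log :: "nat \<Rightarrow> nat \<Rightarrow> real \<Rightarrow> real" where
  "rate_log N d \<alpha> = real d ^ 3 * ln (2 * real d) * sqrt (inverse (real N) * ln (real N / \<alpha>))"

end

theory Submission
  imports
    Defs
    "HOL-Computational_Algebra.Formal_Power_Series"
    "HOL-Computational_Algebra.Polynomial_FPS"
begin

text \<open>The probabilistic part is short. The distance from \<open>y = x + \<xi>\<close> to the nuisance signals in the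
  Fourier norm \<open>v \<mapsto> \<parallel>F\<^sub>N v\<parallel>\<^sub>\<infinity>\<close> is at most \<open>\<parallel>F\<^sub>N \<xi>\<parallel>\<^sub>\<infinity>\<close> under the hypothesis, and
  is at least the distance from \<open>x\<close> minus \<open>\<parallel>F\<^sub>N \<xi>\<parallel>\<^sub>\<infinity>\<close> in general. Outside of an event of
  probability at most \<open>\<alpha>\<close> the noise term is at most the quantile \<open>q\<close>, so the test errs with probability
  at most \<open>\<alpha>\<close> as soon as every signal of the alternative has Fourier distance at least \<open>3 q\<close> from the
  nuisance signals (\<open>separated_basic_test_risk\<close>).

  The alternative is stated in the uniform norm on the time window, so the heart of the matter is
  deterministic (\<open>exp_sums_uniform_bound\<close>): a solution \<open>x\<close> of a recurrence of order \<open>d\<close> whose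
  characteristic roots all lie on the unit circle satisfies
  \<open>\<bar>x\<^sub>t\<bar> \<le> C d\<^sup>3 ln (2 d) N\<^sup>-\<^sup>1\<^sup>/\<^sup>2 \<parallel>F\<^sub>N x\<parallel>\<^sub>\<infinity>\<close> for \<open>t < N\<close>. It is applied to
  the difference of a signal of the alternative and a nuisance signal, where \<open>d = d\<^sub>n + d\<^sub>s\<close>.
  Suppose that \<open>x\<^sub>t = \<Sum>\<^sub>k g\<^sub>k x\<^bsub>t-k\<^esub>\<close> for all such \<open>x\<close> and all \<open>t\<close>, with \<open>g\<close> supported in
  \<open>{0..M}\<close>. Using this identity twice and expanding \<open>x\<close> by Fourier inversion gives
  \<open>x\<^sub>t = N\<^sup>-\<^sup>1\<^sup>/\<^sup>2 \<Sum>\<^sub>\<mu> (F\<^sub>N x)(\<mu>) \<mu>\<^sup>-\<^sup>t G(\<mu>)\<^sup>2\<close> with \<open>G(\<mu>) = \<Sum>\<^sub>k g\<^sub>k \<mu>\<^sup>k\<close>, whenever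
  \<open>2 M \<le> t\<close>. By Parseval the sum of \<open>\<bar>G(\<mu>)\<bar>\<^sup>2\<close> is \<open>N \<parallel>g\<parallel>\<^sub>2\<^sup>2\<close>, so everything reduces to a filter
  with \<open>\<parallel>g\<parallel>\<^sub>2\<^sup>2\<close> of order \<open>d\<^sup>3 ln (2 d) / N\<close>. The first half of the window is reached by time reversal.

  The filter is a composition of two. A coarse one, \<open>predictor_of_bounded_energy\<close>, predicts \<open>x\<^sub>t\<close> from the
  values \<open>x\<^bsub>t-h\<^esub>, x\<^bsub>t-2h\<^esub>, \<dots>\<close>, of which it uses some \<open>d\<^sup>2 ln (2 d)\<close>, with bounded Euclidean norm. It is
  \<open>1 - p S\<close>, where \<open>p\<close> is the characteristic polynomial and \<open>S\<close> a truncation of the power series of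
  \<open>1 / p(\<rho> \<zeta>)\<close> with \<open>\<rho>\<close> slightly less than one: on the unit circle the quotient of \<open>p(\<zeta>)\<close> by
  \<open>p(\<rho> \<zeta>)\<close> is bounded by a constant. The second,
  \<open>interior_filter\<close>, replaces every \<open>x\<^bsub>t-kh\<^esub>\<close> by a combination of \<open>h\<close> consecutive values around it, of
  squared norm at most \<open>d/h\<close>: the restrictions of the signals to an interval of length \<open>h\<close> span
  a space of dimension at most \<open>d\<close>, whose orthogonal projection has trace at most \<open>d\<close> and hence some
  row of squared norm at most \<open>d/h\<close>. The blocks for different \<open>k\<close> do not overlap, so squared norms
  multiply, which gives order \<open>d/h\<close> for \<open>M\<close> of order \<open>d\<^sup>2 ln (2 d) h\<close>.

  The two forms of the condition on \<open>\<rho>\<close> agree because \<open>q\<close> is comparable to \<open>sqrt (ln (N/\<alpha>))\<close>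
  (\<open>q_quantile_bounds\<close>). The upper bound is a union bound over the frequencies. The lower bound
  comes from a second moment estimate for a sum of exponentials of orthonormal linear forms of the noise.\<close>

section \<open>Complex signals annihilated by a polynomial of the shift\<close>

definition act :: "complex poly \<Rightarrow> (int \<Rightarrow> complex) \<Rightarrow> int \<Rightarrow> complex" where
  "act p x t = (\<Sum>k\<le>degree p. coeff p k * x (t - int k))"

definition root_poly :: "complex multiset \<Rightarrow> complex poly" where
  "root_poly Z = (\<Prod>z\<in>#Z. [:1, - z:])"

definition exp_sums :: "complex multiset \<Rightarrow> (int \<Rightarrow> complex) set" where
  "exp_sums Z = {x. \<forall>t. act (root_poly Z) x t = 0}"

lemma act_eq:
  assumes "degree p \<le> n"
  shows "act p x t = (\<Sum>k\<le>n. coeff p k * x (t - int k))"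
  unfolding act_def using assms
  by (intro sum.mono_neutral_left) (auto simp: coeff_eq_0)

lemma act_pCons: "act (pCons a p) x t = a * x t + act p x (t - 1)"
proof -
  have "act (pCons a p) x t = (\<Sum>k\<le>Suc (degree p). coeff (pCons a p) k * x (t - int k))"
    by (rule act_eq) (rule degree_pCons_le)
  also have "\<dots> = a * x t + (\<Sum>k\<le>degree p. coeff p k * x (t - 1 - int k))"
    by (subst sum.atMost_Suc_shift) (simp add: algebra_simps)
  finally show ?thesis by (simp add: act_def)
qed

lemma act_0 [simp]: "act 0 x t = 0"
  by (simp add: act_def)

lemma act_add: "act (p + q) x t = act p x t + act q x t"
proof -
  have "degree (p + q) \<le> max (degree p) (degree q)" by (rule degree_add_le_max)
  then show ?thesis
    by (simp add: act_eq[of _ "max (degree p) (degree q)"] sum.distrib algebra_simps)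
qed

lemma act_smult: "act (smult a p) x t = a * act p x t"
  using act_eq[of "smult a p" "degree p" x t] degree_smult_le[of a p]
  by (simp add: act_def sum_distrib_left mult.assoc)

lemma act_mult: "act (p * q) x t = act p (act q x) t"
proof (induction p arbitrary: t)
  case (pCons a p)
  have "act (pCons a p * q) x t = act (smult a q) x t + act (pCons 0 (p * q)) x t"
    by (simp add: act_add)
  then show ?case
    by (simp add: act_smult act_pCons pCons.IH)
qed simp

lemma act_one [simp]: "act 1 x t = x t"
  by (simp add: act_def)

lemma act_signal_zero [simp]: "act p (\<lambda>_. 0) t = 0"
  by (simp add: act_def)

lemma act_diff: "act (p - q) x t = act p x t - act q x t"
  using act_add[of p "- q" x t] act_smult[of "-1" q x t] by simp

lemma act_dvd:
  assumes "root_poly Z dvd p" "x \<in> exp_sums Z"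
  shows "act p x t = 0"
proof -
  obtain q where q: "p = q * root_poly Z" using assms(1) by (metis dvdE mult.commute)
  have "act (root_poly Z) x = (\<lambda>_. 0)" using assms(2) by (auto simp: exp_sums_def)
  then show ?thesis by (simp add: q act_mult)
qed

lemma act_translate: "act p (\<lambda>s. x (a + s)) t = act p x (a + t)"
  by (simp add: act_def algebra_simps)

lemma exp_sums_translate: "x \<in> exp_sums Z \<Longrightarrow> (\<lambda>s. x (a + s)) \<in> exp_sums Z"
  by (simp add: exp_sums_def act_translate)

lemma act_pcompose_monom:
  "act (pcompose p (monom 1 h)) x t = (\<Sum>k\<le>degree p. coeff p k * x (t - int (k * h)))"
proof -
  have monom: "act (monom 1 h * q) x t = act q x (t - int h)" for q t
    by (subst act_mult, subst act_eq[of _ h])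
       (auto simp: degree_monom_le coeff_monom if_distrib[of "\<lambda>c. c * _"] cong: if_cong)
  have "act (pcompose p (monom 1 h)) x t = act p (\<lambda>k. x (t + int h * k)) 0" for t
  proof (induction p arbitrary: t)
    case (pCons a p)
    have "act (pcompose (pCons a p) (monom 1 h)) x t
      = a * x t + act (pcompose p (monom 1 h)) x (t - int h)"
      by (simp add: pcompose_pCons act_add monom act_pCons)
    also have "\<dots> = a * x t + act p (\<lambda>k. x (t + int h * (-1 + k))) 0"
      by (simp add: pCons.IH algebra_simps)
    also have "\<dots> = act (pCons a p) (\<lambda>k. x (t + int h * k)) 0"
      using act_translate[of p "\<lambda>k. x (t + int h * k)" "-1" 0] by (simp add: act_pCons)
    finally show ?case .
  qed simp
  then show ?thesis by (simp add: act_def mult.commute)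
qed

lemma root_poly_empty [simp]: "root_poly {#} = 1"
  by (simp add: root_poly_def)

lemma root_poly_add_mset [simp]: "root_poly (add_mset z Z) = [:1, -z:] * root_poly Z"
  by (simp add: root_poly_def)

lemma coeff_0_root_poly [simp]: "coeff (root_poly Z) 0 = 1"
  by (induction Z) (simp_all add: coeff_mult)

lemma root_poly_nonzero [simp]: "root_poly Z \<noteq> 0"
  using coeff_0_root_poly[of Z] by (metis coeff_0 zero_neq_one)

lemma degree_root_poly:
  assumes "0 \<notin># Z" shows "degree (root_poly Z) = size Z"
  using assms by (induction Z) (simp_all del: mult_pCons_left add: degree_mult_eq)

text \<open>A signal sampled at every \<open>h\<close>-th time is again an exponential sum, with the roots raised to the power \<open>h\<close>.
  For polynomials this says that \<open>1 - z \<zeta>\<close> divides \<open>1 - (z \<zeta>)\<^sup>h\<close>.\<close>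

lemma root_poly_dvd_dilate:
  "root_poly Z dvd pcompose (root_poly (image_mset (\<lambda>z. z ^ h) Z)) (monom 1 h)"
proof (induction Z)
  case (add z Z)
  have "[:1, - z:] dvd [:1:] - monom (z ^ h) h"
  proof -
    have z: "[:0, z:] ^ h = monom (z ^ h) h"
      by (induction h) (simp_all add: monom_0 monom_Suc smult_monom one_pCons)
    have "[:1, - z:] = 1 - [:0, z:]" by (simp add: one_pCons)
    also have "\<dots> dvd 1 - [:0, z:] ^ h"
      by (metis one_diff_power_eq dvd_triv_left)
    finally show ?thesis by (simp add: z one_pCons)
  qed
  also have "[:1:] - monom (z ^ h) h = pcompose [:1, - (z ^ h):] (monom 1 h)"
    by (simp add: pcompose_pCons smult_monom minus_monom[symmetric] mult.commute[of "monom 1 h"])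
  finally show ?case
    using add by (simp only: image_mset_add_mset root_poly_add_mset pcompose_mult) (rule mult_dvd_mono)
qed simp

text \<open>Time reversal exchanges a root \<open>z\<close> with \<open>1 / z\<close>, so that a statement about predicting a signal
  from its past also covers its prediction from the future.\<close>

lemma exp_sums_reverse:
  assumes Z: "0 \<notin># Z" and x: "x \<in> exp_sums Z"
  shows "(\<lambda>t. x (a - t)) \<in> exp_sums (image_mset inverse Z)"
proof -
  let ?Z = "image_mset inverse Z"
  let ?P = "root_poly Z"
  define c where "c = prod_mset (image_mset uminus Z)"
  have c: "c \<noteq> 0" using Z unfolding c_def by (induction Z) auto
  have refl: "reflect_poly ?P = smult c (root_poly ?Z)"
    using Z unfolding c_def
  proof (induction Z)
    case (add z Z)
    have "reflect_poly [:1, - z:] = smult (- z) [:1, - inverse z:]"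
      using add.prems by (simp add: reflect_poly_pCons)
    moreover have "reflect_poly (root_poly (add_mset z Z))
        = reflect_poly [:1, - z:] * reflect_poly (root_poly Z)"
      by (simp only: root_poly_add_mset reflect_poly_mult)
    moreover have "reflect_poly (root_poly Z)
        = smult (\<Prod>\<^sub># (image_mset uminus Z)) (root_poly (image_mset inverse Z))"
      using add by simp
    ultimately have "reflect_poly (root_poly (add_mset z Z))
        = smult (- z) [:1, - inverse z:] * smult (\<Prod>\<^sub># (image_mset uminus Z)) (root_poly (image_mset inverse Z))"
      by (simp only:)
    also have "\<dots> = smult (- z * \<Prod>\<^sub># (image_mset uminus Z))
        ([:1, - inverse z:] * root_poly (image_mset inverse Z))"
      by (simp only: mult_smult_left mult_smult_right smult_smult mult.commute)
    finally show ?case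
      by (simp only: image_mset_add_mset root_poly_add_mset prod_mset.add_mset)
  qed simp
  have deg: "degree (root_poly ?Z) = degree ?P"
    using Z by (subst (1 2) degree_root_poly) auto
  have "act (root_poly ?Z) (\<lambda>t. x (a - t)) s = 0" for s
  proof -
    let ?d = "degree ?P"
    have "c * act (root_poly ?Z) (\<lambda>t. x (a - t)) s
        = (\<Sum>k\<le>?d. coeff (reflect_poly ?P) k * x (a - s + int k))"
      by (simp add: act_def deg refl sum_distrib_left algebra_simps)
    also have "\<dots> = (\<Sum>k\<le>?d. coeff ?P k * x (a - s + int ?d - int k))"
      by (rule sum.reindex_bij_witness[of _ "\<lambda>k. ?d - k" "\<lambda>k. ?d - k"])
         (auto simp: coeff_reflect_poly of_nat_diff algebra_simps)
    also have "\<dots> = act ?P x (a - s + int ?d)" by (simp add: act_def)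
    finally show ?thesis using x c by (simp add: exp_sums_def)
  qed
  then show ?thesis by (simp add: exp_sums_def)
qed

section \<open>Prediction of an exponential sum from its past\<close>

definition geom :: "complex \<Rightarrow> complex fps" where
  "geom c = Abs_fps (\<lambda>k. c ^ k)"

lemma geom_inverse: "(1 - fps_const c * fps_X) * geom c = 1"
proof (rule fps_ext)
  fix k show "fps_nth ((1 - fps_const c * fps_X) * geom c) k = fps_nth 1 k"
    by (cases k) (simp_all add: geom_def left_diff_distrib mult.assoc)
qed

lemma nth_linear_mult:
  fixes b :: "complex fps"
  shows
  "fps_nth ((1 - fps_const c * fps_X) * b) k = fps_nth b k - (if k = 0 then 0 else c * fps_nth b (k - 1))"
  by (cases k) (simp_all add: left_diff_distrib mult.assoc)

lemma geom_mult_nth: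
  "fps_nth (geom c * g) k = fps_nth g k + (if k = 0 then 0 else c * fps_nth (geom c * g) (k - 1))"
proof -
  have "(1 - fps_const c * fps_X) * (geom c * g) = g"
    by (metis geom_inverse mult.assoc mult_1_left)
  then have "fps_nth g k = fps_nth (geom c * g) k - (if k = 0 then 0 else c * fps_nth (geom c * g) (k - 1))"
    using nth_linear_mult[of c "geom c * g" k] by (simp only:)
  then show ?thesis by simp
qed

text \<open>On the unit circle \<open>\<bar>1 - z \<zeta>\<bar>\<^sup>2 / \<bar>1 - \<rho> z \<zeta>\<bar>\<^sup>2 \<le> 1/\<rho>\<close>, so multiplication by the quotient
  increases the energy of a power series at most by the factor \<open>1/\<rho>\<close>. The proof works with
  coefficients and covers all partial sums: with \<open>b = g / (1 - \<rho> z \<zeta>)\<close>, the difference of the two sides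
  dominates the telescoping sum of \<open>(1/\<rho> - 1) (\<bar>b\<^sub>k\<bar>\<^sup>2 - \<bar>b\<^bsub>k-1\<^esub>\<bar>\<^sup>2)\<close>.\<close>

lemma energy_moebius_factor:
  fixes \<rho> :: real
  assumes z: "cmod z = 1" and \<rho>: "0 < \<rho>" "\<rho> \<le> 1"
  shows "(\<Sum>k\<le>K. (cmod (fps_nth ((1 - fps_const z * fps_X) * geom (of_real \<rho> * z) * g) k))\<^sup>2)
       \<le> (\<Sum>k\<le>K. (cmod (fps_nth g k))\<^sup>2) / \<rho>"
proof -
  define b where "b = geom (of_real \<rho> * z) * g"
  define f where "f = (1 - fps_const z * fps_X) * b"
  have g: "fps_nth g k = fps_nth b k - (if k = 0 then 0 else of_real \<rho> * z * fps_nth b (k - 1))" for k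
    using geom_mult_nth[of "of_real \<rho> * z" g k] by (simp add: b_def)
  have f: "fps_nth f k = fps_nth b k - (if k = 0 then 0 else z * fps_nth b (k - 1))" for k
    by (simp only: f_def nth_linear_mult)
  have step: "(cmod (u - v))\<^sup>2 + (1/\<rho> - 1) * (cmod u)\<^sup>2 - (1/\<rho> - 1) * (cmod v)\<^sup>2
      \<le> (cmod (u - of_real \<rho> * v))\<^sup>2 / \<rho>" for u v :: complex
  proof -
    have "(cmod (u - of_real \<rho> * v))\<^sup>2 / \<rho>
       - ((cmod (u - v))\<^sup>2 + (1/\<rho> - 1) * (cmod u)\<^sup>2 - (1/\<rho> - 1) * (cmod v)\<^sup>2)
       = (1 - \<rho>)\<^sup>2 / \<rho> * (cmod v)\<^sup>2"
      using \<rho> unfolding cmod_power2 by (simp add: field_simps power2_eq_square)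
    moreover have "(1 - \<rho>)\<^sup>2 / \<rho> * (cmod v)\<^sup>2 \<ge> 0" using \<rho> by simp
    ultimately show ?thesis by linarith
  qed
  have "(\<Sum>k\<le>K. (cmod (fps_nth f k))\<^sup>2) + (1/\<rho> - 1) * (cmod (fps_nth b K))\<^sup>2
      \<le> (\<Sum>k\<le>K. (cmod (fps_nth g k))\<^sup>2) / \<rho>"
  proof (induction K)
    case 0
    then show ?case by (simp add: f g field_simps)
  next
    case (Suc K)
    have "(cmod (fps_nth f (Suc K)))\<^sup>2 + (1/\<rho> - 1) * (cmod (fps_nth b (Suc K)))\<^sup>2
        - (1/\<rho> - 1) * (cmod (fps_nth b K))\<^sup>2 \<le> (cmod (fps_nth g (Suc K)))\<^sup>2 / \<rho>"
      using step[of "fps_nth b (Suc K)" "z * fps_nth b K"]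
      by (simp add: f g norm_mult z mult.assoc)
    with Suc show ?case by (simp add: add_divide_distrib)
  qed
  moreover have "(1/\<rho> - 1) * (cmod (fps_nth b K))\<^sup>2 \<ge> 0" using \<rho> by simp
  ultimately show ?thesis
    unfolding f_def b_def by (simp add: mult.assoc)
qed

text \<open>The power series \<open>1 / p(\<rho> \<zeta>)\<close>, where \<open>p\<close> is the polynomial \<open>root_poly Z\<close>.\<close>

definition damped_inverse :: "real \<Rightarrow> complex multiset \<Rightarrow> complex fps" where
  "damped_inverse \<rho> Z = (\<Prod>z\<in>#Z. geom (of_real \<rho> * z))"

lemma fps_of_root_poly_add:
  "fps_of_poly (root_poly (add_mset z Z)) = (1 - fps_const z * fps_X) * fps_of_poly (root_poly Z)"
proof -
  have "fps_of_poly [:1, - z:] = 1 - fps_const z * fps_X"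
    by (simp add: fps_of_poly_pCons)
  then show ?thesis by (simp only: root_poly_add_mset fps_of_poly_mult)
qed

lemma energy_damped_quotient:
  assumes Z: "\<forall>z\<in>#Z. cmod z = 1" and \<rho>: "0 < \<rho>" "\<rho> \<le> 1"
  shows "(\<Sum>k\<le>K. (cmod (fps_nth (fps_of_poly (root_poly Z) * damped_inverse \<rho> Z) k))\<^sup>2) \<le> (1/\<rho>) ^ size Z"
  using Z
proof (induction Z)
  case empty
  have "(\<Sum>k\<le>K. (cmod (fps_nth (1 :: complex fps) k))\<^sup>2) = (\<Sum>k\<le>K. if k = 0 then 1 else 0)"
    by (intro sum.cong) auto
  then show ?case by (simp add: damped_inverse_def)
next
  case (add z Z)
  have "fps_of_poly (root_poly (add_mset z Z)) * damped_inverse \<rho> (add_mset z Z)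
     = (1 - fps_const z * fps_X) * geom (of_real \<rho> * z) * (fps_of_poly (root_poly Z) * damped_inverse \<rho> Z)"
    by (simp only: fps_of_root_poly_add) (simp add: damped_inverse_def mult_ac)
  moreover have "(\<Sum>k\<le>K. (cmod (fps_nth (fps_of_poly (root_poly Z) * damped_inverse \<rho> Z) k))\<^sup>2) / \<rho>
     \<le> (1/\<rho>) ^ size Z / \<rho>"
    using add \<rho> by (intro divide_right_mono) auto
  ultimately show ?case
    using energy_moebius_factor[of z \<rho> "fps_of_poly (root_poly Z) * damped_inverse \<rho> Z" K] add.prems \<rho>
    by (auto simp: mult_ac)
qed

text \<open>Writing the damping factor as \<open>\<sigma>\<^sup>2\<close> leaves half of the decay for the geometric sum in each convolution,
  so that no binomial coefficients appear.\<close>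

lemma damped_inverse_decay:
  assumes Z: "\<forall>z\<in>#Z. cmod z = 1" and \<sigma>: "0 < \<sigma>" "\<sigma> < 1"
  shows "cmod (fps_nth (damped_inverse (\<sigma>\<^sup>2) Z) k) \<le> (1 / (1 - \<sigma>)) ^ size Z * \<sigma> ^ k"
  using Z
proof (induction Z arbitrary: k)
  case empty
  then show ?case using \<sigma> by (auto simp: damped_inverse_def)
next
  case (add z Z)
  define M where "M = (1 / (1 - \<sigma>)) ^ size Z"
  define g where "g = damped_inverse (\<sigma>\<^sup>2) Z"
  have g: "cmod (fps_nth g k) \<le> M * \<sigma> ^ k" for k
    using add by (auto simp: g_def M_def)
  have "cmod (fps_nth (geom (of_real (\<sigma>\<^sup>2) * z) * g) k) \<le> 1 / (1 - \<sigma>) * M * \<sigma> ^ k"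
  proof (induction k)
    case 0
    have "M \<ge> 0" using \<sigma> by (simp add: M_def)
    then have "M * 1 \<le> M * (1 / (1 - \<sigma>))" using \<sigma> by (intro mult_left_mono) auto
    with g[of 0] show ?case by (subst geom_mult_nth) simp
  next
    case (Suc k)
    have "cmod (fps_nth (geom (of_real (\<sigma>\<^sup>2) * z) * g) (Suc k))
        \<le> cmod (fps_nth g (Suc k)) + \<sigma>\<^sup>2 * cmod (fps_nth (geom (of_real (\<sigma>\<^sup>2) * z) * g) k)"
      using norm_triangle_ineq[of "fps_nth g (Suc k)" "of_real (\<sigma>\<^sup>2) * z * fps_nth (geom (of_real (\<sigma>\<^sup>2) * z) * g) k"] add.prems
      by (subst geom_mult_nth) (simp add: norm_mult norm_power)
    also have "\<dots> \<le> M * \<sigma> ^ Suc k + \<sigma>\<^sup>2 * (1 / (1 - \<sigma>) * M * \<sigma> ^ k)"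
      by (intro add_mono mult_left_mono g Suc.IH) simp
    also have "\<dots> = 1 / (1 - \<sigma>) * M * \<sigma> ^ Suc k"
      using \<sigma> by (simp add: field_simps power2_eq_square)
    finally show ?case .
  qed
  moreover have "damped_inverse (\<sigma>\<^sup>2) (add_mset z Z) = geom (of_real (\<sigma>\<^sup>2) * z) * g"
    by (simp add: damped_inverse_def g_def)
  ultimately show ?case by (simp add: M_def)
qed

text \<open>The coefficient sequence is bounded by a geometric one whose ratio is at least \<open>1/2\<close>; a shift of it by one place
  is at most twice as large, which accounts for the base \<open>3 = 1 + 2\<close>.\<close>

lemma root_poly_mult_decay:
  assumes Z: "\<forall>z\<in>#Z. cmod z = 1" and \<sigma>: "1/2 \<le> \<sigma>" and S: "\<And>k. cmod (coeff S k) \<le> M * \<sigma> ^ k"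
  shows "cmod (coeff (root_poly Z * S) k) \<le> 3 ^ size Z * M * \<sigma> ^ k"
  using Z
proof (induction Z arbitrary: k)
  case empty
  then show ?case using S by simp
next
  case (add z Z)
  define p where "p = root_poly Z * S"
  define B where "B = 3 ^ size Z * M"
  have p: "cmod (coeff p k) \<le> B * \<sigma> ^ k" for k
    using add by (auto simp: p_def B_def)
  have B: "B \<ge> 0" using p[of 0] norm_ge_zero[of "coeff p 0"] by (simp del: norm_ge_zero)
  have eq: "root_poly (add_mset z Z) * S = p + smult (- z) (pCons 0 p)"
    by (simp add: p_def mult.assoc algebra_simps)
  show ?case
  proof (cases k)
    case 0
    then have "cmod (coeff (root_poly (add_mset z Z) * S) k) \<le> B"
      using p[of 0] unfolding eq by simp
    then show ?thesis using 0 B by (simp add: B_def)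
  next
    case (Suc j)
    have "cmod (coeff (root_poly (add_mset z Z) * S) k) \<le> cmod (coeff p (Suc j)) + cmod (coeff p j)"
      using norm_triangle_ineq4[of "coeff p (Suc j)" "z * coeff p j"] add.prems
      unfolding eq Suc by (simp add: norm_mult)
    also have "\<dots> \<le> B * \<sigma> ^ Suc j + B * \<sigma> ^ j"
      by (intro add_mono p)
    also have "\<dots> \<le> B * \<sigma> ^ Suc j + B * (2 * \<sigma> * \<sigma> ^ j)"
      using B \<sigma> mult_right_mono[of 1 "2 * \<sigma>" "\<sigma> ^ j"] by (intro add_mono mult_left_mono) auto
    also have "\<dots> = 3 ^ size (add_mset z Z) * M * \<sigma> ^ k"
      by (simp add: B_def Suc algebra_simps)
    finally show ?thesis .
  qed
qed

lemma ln_double_ge: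
  assumes "d \<ge> 1" shows "ln (2 * real d) \<ge> 2 / 3"
proof -
  have "ln 2 \<le> ln (2 * real d)" using assms by (intro ln_mono) auto
  then show ?thesis using ln2_ge_two_thirds by linarith
qed

text \<open>The length \<open>18 d\<^sup>2 ln (2 d)\<close> is chosen so that the coefficients created by truncation, which are
  at most \<open>(12 d)\<^sup>d \<sigma>\<^sup>k\<close> beyond the cut, have total energy at most one.\<close>

lemma truncation_energy_le:
  fixes d n :: nat
  assumes d: "d \<ge> 1" and n: "18 * real d ^ 2 * ln (2 * real d) \<le> real n"
  shows "d * ((12 * real d) ^ d * (1 - 1 / (4 * real d)) ^ Suc n)\<^sup>2 \<le> 1"
proof -
  define \<sigma> where "\<sigma> = 1 - 1 / (4 * real d)"
  have \<sigma>: "\<sigma> > 0" using d by (simp add: \<sigma>_def field_simps)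
  have ln\<sigma>: "ln \<sigma> \<le> - 1 / (4 * real d)"
    using ln_le_minus_one[OF \<sigma>] by (simp add: \<sigma>_def)
  have L: "ln (12 * real d) \<le> 4 * ln (2 * real d)"
  proof -
    have "real d * 1 \<le> real d * real d ^ 3" using d by (intro mult_left_mono) auto
    then have "12 * real d \<le> (2 * real d) ^ 4" by (simp add: power_mult_distrib power_numeral_reduce)
    then have "ln (12 * real d) \<le> ln ((2 * real d) ^ 4)" using d by (intro ln_mono) auto
    also have "\<dots> = 4 * ln (2 * real d)" using d by (subst ln_realpow) auto
    finally show ?thesis .
  qed
  have "ln (d * ((12 * real d) ^ d * \<sigma> ^ Suc n)\<^sup>2)
      = ln d + 2 * (d * ln (12 * real d) + Suc n * ln \<sigma>)"
    using d \<sigma> by (simp add: ln_mult ln_realpow algebra_simps del: power_Suc of_nat_Suc)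
  also have "\<dots> \<le> ln (2 * real d) + 2 * (d * (4 * ln (2 * real d)) + real n * (- 1 / (4 * real d)))"
  proof -
    have "Suc n * ln \<sigma> \<le> real n * ln \<sigma>"
      using ln\<sigma> d by (intro mult_right_mono_neg) (auto intro: order.trans)
    also have "\<dots> \<le> real n * (- 1 / (4 * real d))" using ln\<sigma> by (intro mult_left_mono) auto
    finally have "Suc n * ln \<sigma> \<le> real n * (- 1 / (4 * real d))" .
    moreover have "ln d \<le> ln (2 * real d)" using d by (intro ln_mono) auto
    moreover have "d * ln (12 * real d) \<le> d * (4 * ln (2 * real d))" using L by (intro mult_left_mono) auto
    ultimately show ?thesis by argo
  qed
  also have "\<dots> \<le> ln (2 * real d) + 8 * d * ln (2 * real d) - 9 * d * ln (2 * real d)"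
  proof -
    have "9 * d * ln (2 * real d) \<le> real n / (2 * real d)"
      using n d by (simp add: field_simps power2_eq_square)
    then show ?thesis by (simp add: algebra_simps)
  qed
  also have "\<dots> \<le> 0"
  proof -
    have "1 * ln (2 * real d) \<le> d * ln (2 * real d)"
      using d ln_double_ge[OF d] by (intro mult_right_mono) auto
    then show ?thesis by (simp add: algebra_simps)
  qed
  finally have "ln (d * ((12 * real d) ^ d * \<sigma> ^ Suc n)\<^sup>2) \<le> 0" .
  moreover have "0 < d * ((12 * real d) ^ d * \<sigma> ^ Suc n)\<^sup>2" using d \<sigma> by simp
  ultimately show ?thesis unfolding \<sigma>_def by (subst (asm) ln_le_zero_iff) auto
qed

text \<open>With \<open>p = root_poly Z\<close>, let \<open>S\<close> be the truncation of \<open>1 / p(\<rho> \<zeta>)\<close> and \<open>Q = 1 - p S\<close>. The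
  divisibility survives the truncation, because it is the cofactor that is truncated, and below the cut the coefficients of
  \<open>p S\<close> are those of \<open>p(\<zeta>) / p(\<rho> \<zeta>)\<close>, whose energy is at most \<open>\<rho>\<^sup>-\<^sup>d \<le> 2\<close> for the present
  choice of \<open>\<rho>\<close>.\<close>

lemma predictor_of_bounded_energy:
  assumes Z: "\<forall>z\<in>#Z. cmod z = 1" and d: "size Z = d" "d \<ge> 1"
  obtains Q where "coeff Q 0 = 0" "real (degree Q) \<le> 21 * real d ^ 2 * ln (2 * real d)"
    "root_poly Z dvd 1 - Q" "(\<Sum>k\<le>degree Q. (cmod (coeff Q k))\<^sup>2) \<le> 3"
proof -
  define \<sigma> where "\<sigma> = 1 - 1 / (4 * real d)"
  have \<sigma>: "3/4 \<le> \<sigma>" "\<sigma> < 1" using d by (auto simp: \<sigma>_def field_simps)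
  define n where "n = nat \<lceil>18 * real d ^ 2 * ln (2 * real d)\<rceil>"
  have L: "ln (2 * real d) \<ge> 2/3" using ln_double_ge d by simp
  have n: "18 * real d ^ 2 * ln (2 * real d) \<le> real n" "real n \<le> 18 * real d ^ 2 * ln (2 * real d) + 1"
    using L by (auto simp: n_def intro!: real_nat_ceiling_ge of_nat_ceiling)
  define S where "S = Abs_poly (\<lambda>k. if k \<le> n then fps_nth (damped_inverse (\<sigma>\<^sup>2) Z) k else 0)"
  have S: "coeff S k = (if k \<le> n then fps_nth (damped_inverse (\<sigma>\<^sup>2) Z) k else 0)" for k
    unfolding S_def by (subst coeff_Abs_poly[of n]) auto
  \<comment> \<open>Below the cut this is \<open>p(\<zeta>) / p(\<sigma>\<^sup>2 \<zeta>)\<close>; above it only the decay of the coefficients is used.\<close>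
  define \<phi> where "\<phi> = root_poly Z * S"
  have low: "coeff \<phi> k = fps_nth (fps_of_poly (root_poly Z) * damped_inverse (\<sigma>\<^sup>2) Z) k" if "k \<le> n" for k
    using that by (auto simp: \<phi>_def coeff_mult fps_mult_nth S atMost_atLeast0 intro!: sum.cong)
  have high: "cmod (coeff \<phi> k) \<le> (12 * real d) ^ d * \<sigma> ^ k" for k
  proof -
    have "cmod (coeff S k) \<le> (4 * real d) ^ d * \<sigma> ^ k" for k
      using damped_inverse_decay[OF Z, of \<sigma> k] \<sigma> d by (auto simp: S) (simp add: \<sigma>_def)
    then have "cmod (coeff \<phi> k) \<le> 3 ^ d * (4 * real d) ^ d * \<sigma> ^ k"
      using root_poly_mult_decay[OF Z, of \<sigma> S] \<sigma> d unfolding \<phi>_def by auto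
    also have "3 ^ d * (4 * real d) ^ d = (12 * real d) ^ d"
      by (subst power_mult_distrib[symmetric]) simp
    finally show ?thesis .
  qed
  have deg: "degree \<phi> \<le> n + d"
  proof -
    have "degree S \<le> n" by (rule degree_le) (simp add: S)
    moreover have "degree (root_poly Z) = d" using Z d by (subst degree_root_poly) auto
    ultimately show ?thesis using degree_mult_le[of "root_poly Z" S] by (simp add: \<phi>_def)
  qed
  have low_energy: "(\<Sum>k\<le>n. (cmod (coeff \<phi> k))\<^sup>2) \<le> 2"
  proof -
    have "(\<Sum>k\<le>n. (cmod (coeff \<phi> k))\<^sup>2) \<le> (1 / \<sigma>\<^sup>2) ^ d"
      using energy_damped_quotient[OF Z, of "\<sigma>\<^sup>2" n] \<sigma> d low by (simp add: power_le_one)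
    also have "\<dots> = 1 / (\<sigma> ^ (2 * d))" by (simp add: power_mult power_one_over)
    also have "\<dots> \<le> 1 / (1/2)"
    proof -
      \<comment> \<open>This is where \<open>1 - \<sigma> = 1 / (4 d)\<close> matters: the damping may cost no more than a constant factor over \<open>2 d\<close> powers of \<open>\<sigma>\<close>.\<close>
      have "1 + real (2 * d) * (- 1 / (4 * real d)) \<le> (1 + (- 1 / (4 * real d))) ^ (2 * d)"
        using d by (intro Bernoulli_inequality) (simp add: field_simps)
      then have "1 / 2 \<le> \<sigma> ^ (2 * d)" using d by (simp add: \<sigma>_def)
      then show ?thesis by (intro divide_left_mono) auto
    qed
    finally show ?thesis by simp
  qed
  have high_energy: "(\<Sum>k=Suc n..n+d. (cmod (coeff \<phi> k))\<^sup>2) \<le> 1"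
  proof -
    have card: "card {Suc n..n+d} = d" by simp
    have bound: "(cmod (coeff \<phi> k))\<^sup>2 \<le> ((12 * real d) ^ d * \<sigma> ^ Suc n)\<^sup>2" if "k \<in> {Suc n..n+d}" for k
    proof (rule power_mono)
      have "\<sigma> ^ k \<le> \<sigma> ^ Suc n" using that \<sigma> by (intro power_decreasing) auto
      then have "(12 * real d) ^ d * \<sigma> ^ k \<le> (12 * real d) ^ d * \<sigma> ^ Suc n"
        by (intro mult_left_mono) auto
      with high[of k] show "cmod (coeff \<phi> k) \<le> (12 * real d) ^ d * \<sigma> ^ Suc n" by linarith
    qed simp
    have "(\<Sum>k=Suc n..n+d. (cmod (coeff \<phi> k))\<^sup>2) \<le> d * ((12 * real d) ^ d * \<sigma> ^ Suc n)\<^sup>2"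
      using sum_bounded_above[of "{Suc n..n+d}" "\<lambda>k. (cmod (coeff \<phi> k))\<^sup>2", OF bound]
      unfolding card .
    also have "\<dots> \<le> 1" using truncation_energy_le[OF d(2) n(1)] by (simp add: \<sigma>_def)
    finally show ?thesis .
  qed
  have energy: "(\<Sum>k\<le>n+d. (cmod (coeff \<phi> k))\<^sup>2) \<le> 3"
  proof -
    have "{..n+d} = {..n} \<union> {Suc n..n+d}" by auto
    then have "(\<Sum>k\<le>n+d. (cmod (coeff \<phi> k))\<^sup>2)
        = (\<Sum>k\<le>n. (cmod (coeff \<phi> k))\<^sup>2) + (\<Sum>k=Suc n..n+d. (cmod (coeff \<phi> k))\<^sup>2)"
      by (simp add: sum.union_disjoint)
    then show ?thesis using low_energy high_energy by simp
  qed
  have \<phi>0: "coeff \<phi> 0 = 1"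
  proof -
    have "fps_nth (damped_inverse (\<sigma>\<^sup>2) Z) 0 = 1"
      unfolding damped_inverse_def by (induction Z) (auto simp: geom_def)
    then show ?thesis by (simp add: \<phi>_def coeff_mult S)
  qed
  define Q where "Q = 1 - \<phi>"
  have degQ: "degree Q \<le> n + d" unfolding Q_def by (intro degree_diff_le deg) simp
  show ?thesis
  proof
    show "coeff Q 0 = 0" by (simp add: Q_def \<phi>0)
    show "root_poly Z dvd 1 - Q" by (simp add: Q_def \<phi>_def)
    have "real d * 1 \<le> real d * real d" using d by (intro mult_left_mono) auto
    then have "real d + 1 \<le> 2 * real d ^ 2" using d unfolding power2_eq_square by linarith
    also have "\<dots> \<le> 3 * real d ^ 2 * ln (2 * real d)"
      using mult_left_mono[OF L, of "3 * real d ^ 2"] by simp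
    finally have "real (n + d) \<le> 21 * real d ^ 2 * ln (2 * real d)" using n by simp
    then show "real (degree Q) \<le> 21 * real d ^ 2 * ln (2 * real d)"
      using degQ by linarith
    have "(\<Sum>k\<le>degree Q. (cmod (coeff Q k))\<^sup>2) \<le> (\<Sum>k\<le>degree Q. (cmod (coeff \<phi> k))\<^sup>2)"
    proof (rule sum_mono)
      fix k show "(cmod (coeff Q k))\<^sup>2 \<le> (cmod (coeff \<phi> k))\<^sup>2"
        by (cases "k = 0") (auto simp: Q_def \<phi>0)
    qed
    also have "\<dots> \<le> (\<Sum>k\<le>n+d. (cmod (coeff \<phi> k))\<^sup>2)"
      using degQ by (intro sum_mono2) auto
    also have "\<dots> \<le> 3" by (rule energy)
    finally show "(\<Sum>k\<le>degree Q. (cmod (coeff Q k))\<^sup>2) \<le> 3" .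
  qed
qed

section \<open>Short two-sided filters from the trace of a projection\<close>

text \<open>The matrix \<open>K\<close> is the orthogonal projection of \<open>\<complex>\<^sup>L\<close> onto the span of the first \<open>d\<close> vectors; its trace is the
  dimension of the span. It is built up one vector at a time, as in the Gram--Schmidt process.\<close>

lemma projection_kernel:
  fixes v :: "nat \<Rightarrow> nat \<Rightarrow> complex"
  shows "\<exists>K :: nat \<Rightarrow> nat \<Rightarrow> complex.
    (\<forall>s<L. \<forall>t<L. K s t = cnj (K t s)) \<and>
    (\<forall>s<L. \<forall>t<L. (\<Sum>r<L. K s r * K r t) = K s t) \<and>
    (\<Sum>t<L. Re (K t t)) \<le> real d \<and>
    (\<forall>i<d. \<forall>t<L. (\<Sum>s<L. K t s * v i s) = v i t)"
proof (induction d)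
  case 0
  then show ?case by (intro exI[of _ "\<lambda>_ _. 0"]) auto
next
  case (Suc d)
  then obtain K where "(\<forall>s<L. \<forall>t<L. K s t = cnj (K t s)) \<and>
    (\<forall>s<L. \<forall>t<L. (\<Sum>r<L. K s r * K r t) = K s t) \<and>
    (\<Sum>t<L. Re (K t t)) \<le> real d \<and>
    (\<forall>i<d. \<forall>t<L. (\<Sum>s<L. K t s * v i s) = v i t)" ..
  then have herm: "s < L \<Longrightarrow> t < L \<Longrightarrow> K s t = cnj (K t s)"
    and idem: "s < L \<Longrightarrow> t < L \<Longrightarrow> (\<Sum>r<L. K s r * K r t) = K s t"
    and trace: "(\<Sum>t<L. Re (K t t)) \<le> real d"
    and reproduces: "i < d \<Longrightarrow> t < L \<Longrightarrow> (\<Sum>s<L. K t s * v i s) = v i t" for i s t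
    by blast+
  \<comment> \<open>The component of the new vector orthogonal to the previous span.\<close>
  define w where "w t = v d t - (\<Sum>s<L. K t s * v d s)" for t
  define c where "c = (\<Sum>t<L. (cmod (w t))\<^sup>2)"
  have ww: "(\<Sum>t<L. cnj (w t) * w t) = of_real c"
    by (simp only: c_def of_real_sum complex_norm_square) (rule sum.cong, auto)
  show ?case
  proof (cases "c = 0")
    case True
    then have "w t = 0" if "t < L" for t
      using that by (simp add: c_def sum_nonneg_eq_0_iff)
    then have "(\<Sum>s<L. K t s * v d s) = v d t" if "t < L" for t
      using that by (simp add: w_def)
    then have "(\<Sum>s<L. K t s * v i s) = v i t" if "i < Suc d" "t < L" for i t
      using that reproduces by (cases "i = d") auto
    moreover have "(\<Sum>t<L. Re (K t t)) \<le> real (Suc d)" using trace by simp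
    ultimately show ?thesis using herm idem by blast
  next
    case False
    have Kw: "(\<Sum>s<L. K t s * w s) = 0" if t: "t < L" for t
    proof -
      have "(\<Sum>s<L. K t s * w s) = (\<Sum>s<L. K t s * v d s) - (\<Sum>s<L. \<Sum>r<L. K t s * K s r * v d r)"
        by (simp add: w_def right_diff_distrib sum_subtractf sum_distrib_left mult.assoc)
      also have "(\<Sum>s<L. \<Sum>r<L. K t s * K s r * v d r) = (\<Sum>r<L. (\<Sum>s<L. K t s * K s r) * v d r)"
        by (subst sum.swap) (simp add: sum_distrib_right)
      also have "\<dots> = (\<Sum>r<L. K t r * v d r)" by (intro sum.cong) (auto simp: idem t)
      finally show ?thesis by simp
    qed
    have wK: "(\<Sum>s<L. cnj (w s) * K s t) = 0" if t: "t < L" for t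
    proof -
      have "(\<Sum>s<L. cnj (w s) * K s t) = cnj (\<Sum>s<L. K t s * w s)"
        unfolding cnj_sum by (intro sum.cong) (auto simp: herm[OF _ t] mult.commute)
      then show ?thesis by (simp add: Kw t)
    qed
    have wv: "(\<Sum>s<L. cnj (w s) * v d s) = of_real c"
    proof -
      have vd: "v d s = w s + (\<Sum>r<L. K s r * v d r)" for s by (simp add: w_def)
      have "cnj (w s) * v d s = cnj (w s) * w s + (\<Sum>r<L. cnj (w s) * K s r * v d r)" for s
        by (subst vd) (simp only: distrib_left sum_distrib_left mult.assoc)
      then have "(\<Sum>s<L. cnj (w s) * v d s)
          = (\<Sum>s<L. cnj (w s) * w s) + (\<Sum>s<L. \<Sum>r<L. cnj (w s) * K s r * v d r)"
        by (simp only: sum.distrib)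
      also have "(\<Sum>s<L. \<Sum>r<L. cnj (w s) * K s r * v d r) = (\<Sum>r<L. (\<Sum>s<L. cnj (w s) * K s r) * v d r)"
        by (subst sum.swap) (simp add: sum_distrib_right)
      also have "\<dots> = 0" by (simp add: wK)
      finally show ?thesis by (simp add: ww)
    qed
    have wvi: "(\<Sum>s<L. cnj (w s) * v i s) = 0" if i: "i < d" for i
    proof -
      have "(\<Sum>s<L. cnj (w s) * v i s) = (\<Sum>s<L. cnj (w s) * (\<Sum>r<L. K s r * v i r))"
        by (intro sum.cong) (auto simp: reproduces i)
      also have "\<dots> = (\<Sum>s<L. \<Sum>r<L. cnj (w s) * K s r * v i r)"
        by (simp add: sum_distrib_left mult.assoc)
      also have "\<dots> = (\<Sum>r<L. (\<Sum>s<L. cnj (w s) * K s r) * v i r)"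
        by (subst sum.swap) (simp add: sum_distrib_right)
      finally show ?thesis by (simp add: wK)
    qed
    define K' where "K' s t = K s t + w s * cnj (w t) / of_real c" for s t
    have act: "(\<Sum>s<L. K' t s * f s) = (\<Sum>s<L. K t s * f s) + w t * (\<Sum>s<L. cnj (w s) * f s) / of_real c" for t f
      by (simp add: K'_def distrib_right sum.distrib sum_distrib_left sum_divide_distrib mult.assoc)
    have "K' s t = cnj (K' t s)" if "s < L" "t < L" for s t
      by (simp add: K'_def mult.commute flip: herm[OF that])
    moreover have "(\<Sum>r<L. K' s r * K' r t) = K' s t" if st: "s < L" "t < L" for s t
    proof -
      have 1: "(\<Sum>r<L. K s r * K' r t) = K s t"
        using idem[OF st] Kw[OF st(1)] unfolding K'_def
        by (simp add: distrib_left sum.distrib flip: sum_divide_distrib sum_distrib_right mult.assoc)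
      have 2: "(\<Sum>r<L. cnj (w r) * K' r t) = cnj (w t)"
        using wK[OF st(2)] ww False unfolding K'_def
        by (simp add: distrib_left sum.distrib flip: sum_divide_distrib sum_distrib_right mult.assoc)
      show ?thesis by (simp add: act 1 2) (simp add: K'_def)
    qed
    moreover have "(\<Sum>t<L. Re (K' t t)) \<le> real (Suc d)"
    proof -
      have "Re (K' t t) = Re (K t t) + (cmod (w t))\<^sup>2 / c" for t
        by (simp add: K'_def flip: complex_norm_square of_real_divide)
      then have "(\<Sum>t<L. Re (K' t t)) = (\<Sum>t<L. Re (K t t)) + c / c"
        by (simp only: sum.distrib sum_divide_distrib[symmetric] c_def[symmetric])
      then show ?thesis using trace False by simp
    qed
    moreover have "(\<Sum>s<L. K' t s * v i s) = v i t" if "i < Suc d" "t < L" for i t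
    proof (cases "i = d")
      case True
      then show ?thesis using False wv by (simp add: act w_def)
    next
      case False
      with that have "i < d" by simp
      then show ?thesis using that by (simp add: act wvi reproduces)
    qed
    ultimately show ?thesis by blast
  qed
qed

text \<open>The recurrence has leading coefficient one, so it expresses every later value by the first \<open>size Z\<close> values. The
  restrictions of the signals to any interval therefore lie in the span of \<open>size Z\<close> fixed vectors.\<close>

lemma exp_sums_dimension:
  assumes Z: "0 \<notin># Z"
  obtains v where "\<And>x t. x \<in> exp_sums Z \<Longrightarrow> x (int t) = (\<Sum>i<size Z. v i t * x (int i))"
proof -
  let ?d = "size Z"
  let ?P = "root_poly Z"
  have deg: "degree ?P = ?d" by (rule degree_root_poly[OF Z])
  have "\<exists>c. \<forall>x\<in>exp_sums Z. x (int t) = (\<Sum>i<?d. c i * x (int i))" for t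
  proof (induction t rule: less_induct)
    case (less t)
    show ?case
    proof (cases "t < ?d")
      case True
      then show ?thesis by (intro exI[of _ "\<lambda>i. if i = t then 1 else 0"]) (simp add: if_distrib[of "\<lambda>a. a * _"] cong: if_cong)
    next
      case False
      have "\<forall>k\<in>{1..?d}. \<exists>c. \<forall>x\<in>exp_sums Z. x (int (t - k)) = (\<Sum>i<?d. c i * x (int i))"
      proof
        fix k assume "k \<in> {1..?d}"
        with False have "t - k < t" by auto
        from less[OF this] show "\<exists>c. \<forall>x\<in>exp_sums Z. x (int (t - k)) = (\<Sum>i<?d. c i * x (int i))" .
      qed
      from bchoice[OF this] obtain c
        where c: "\<And>k x. k \<in> {1..?d} \<Longrightarrow> x \<in> exp_sums Z \<Longrightarrow> x (int (t - k)) = (\<Sum>i<?d. c k i * x (int i))"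
        by blast
      have "x (int t) = (\<Sum>i<?d. (\<Sum>k=1..?d. - coeff ?P k * c k i) * x (int i))" if x: "x \<in> exp_sums Z" for x
      proof -
        have "{..?d} = insert 0 {1..?d}" by auto
        then have "0 = x (int t) + (\<Sum>k=1..?d. coeff ?P k * x (int t - int k))"
          using x deg by (auto simp: exp_sums_def act_def)
        also have "(\<Sum>k=1..?d. coeff ?P k * x (int t - int k)) = (\<Sum>k=1..?d. coeff ?P k * x (int (t - k)))"
          using False by (intro sum.cong) (auto simp: of_nat_diff)
        finally have "x (int t) = (\<Sum>k=1..?d. - coeff ?P k * x (int (t - k)))"
          by (simp add: sum_negf add_eq_0_iff2)
        also have "\<dots> = (\<Sum>k=1..?d. \<Sum>i<?d. - coeff ?P k * c k i * x (int i))"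
          by (intro sum.cong refl) (simp add: c[OF _ x] sum_distrib_left mult.assoc)
        also have "\<dots> = (\<Sum>i<?d. (\<Sum>k=1..?d. - coeff ?P k * c k i) * x (int i))"
          by (subst sum.swap) (simp add: sum_distrib_right)
        finally show ?thesis .
      qed
      then show ?thesis by (intro exI[of _ "\<lambda>i. \<Sum>k=1..?d. - coeff ?P k * c k i"]) blast
    qed
  qed
  then have "\<forall>t. \<exists>c. \<forall>x\<in>exp_sums Z. x (int t) = (\<Sum>i<?d. c i * x (int i))" by blast
  from choice[OF this] obtain c where "\<forall>t. \<forall>x\<in>exp_sums Z. x (int t) = (\<Sum>i<?d. c t i * x (int i))" ..
  then have "x (int t) = (\<Sum>i<?d. c t i * x (int i))" if "x \<in> exp_sums Z" for x t using that by blast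
  then show ?thesis by (rule that[of "\<lambda>i t. c t i"])
qed

text \<open>The projection \<open>K\<close> onto the span of the restricted signals reproduces them, and \<open>\<Sum>\<^sub>s \<bar>K j s\<bar>\<^sup>2 = K j j\<close>.
  As the trace is at most \<open>size Z\<close>, some row \<open>j\<close> has energy at most \<open>size Z / L\<close>. Translation invariance then
  moves this filter to every place.\<close>

lemma interior_filter:
  assumes Z: "0 \<notin># Z" and L: "L \<ge> 1"
  obtains j r where "j < L" "\<And>x t. x \<in> exp_sums Z \<Longrightarrow> x (t + int j) = (\<Sum>s<L. r s * x (t + int s))"
    "(\<Sum>s<L. (cmod (r s))\<^sup>2) \<le> real (size Z) / real L"
proof -
  let ?d = "size Z"
  obtain v where v: "\<And>x t. x \<in> exp_sums Z \<Longrightarrow> x (int t) = (\<Sum>i<?d. v i t * x (int i))"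
    using exp_sums_dimension[OF Z] by blast
  obtain K where "(\<forall>s<L. \<forall>t<L. K s t = cnj (K t s)) \<and>
    (\<forall>s<L. \<forall>t<L. (\<Sum>r<L. K s r * K r t) = K s t) \<and>
    (\<Sum>t<L. Re (K t t)) \<le> real ?d \<and>
    (\<forall>i<?d. \<forall>t<L. (\<Sum>s<L. K t s * v i s) = v i t)"
    using projection_kernel[of L ?d v] ..
  then have herm: "s < L \<Longrightarrow> t < L \<Longrightarrow> K s t = cnj (K t s)"
    and idem: "s < L \<Longrightarrow> t < L \<Longrightarrow> (\<Sum>r<L. K s r * K r t) = K s t"
    and trace: "(\<Sum>t<L. Re (K t t)) \<le> real ?d"
    and reproduces: "i < ?d \<Longrightarrow> t < L \<Longrightarrow> (\<Sum>s<L. K t s * v i s) = v i t" for i s t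
    by blast+
  obtain j where j: "j < L" "Re (K j j) \<le> ?d / L"
  proof (rule ccontr)
    assume "\<not> thesis"
    then have "\<And>t. t < L \<Longrightarrow> ?d / L < Re (K t t)" using that by force
    then have "(\<Sum>t<L. ?d / L) < (\<Sum>t<L. Re (K t t))"
      using L by (intro sum_strict_mono) (auto simp: lessThan_empty_iff)
    then show False using trace L by simp
  qed
  have "x (t + int j) = (\<Sum>s<L. K j s * x (t + int s))" if x: "x \<in> exp_sums Z" for x t
  proof -
    have y: "x (t + int s) = (\<Sum>i<?d. v i s * x (t + int i))" for s
      by (rule v[OF exp_sums_translate[OF x, of t]])
    have "(\<Sum>s<L. K j s * x (t + int s)) = (\<Sum>s<L. \<Sum>i<?d. K j s * v i s * x (t + int i))"
      by (subst y) (simp add: sum_distrib_left mult.assoc)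
    also have "\<dots> = (\<Sum>i<?d. (\<Sum>s<L. K j s * v i s) * x (t + int i))"
      by (subst sum.swap) (simp add: sum_distrib_right)
    also have "\<dots> = x (t + int j)" using y[of j] by (simp add: reproduces j)
    finally show ?thesis by simp
  qed
  moreover have "(\<Sum>s<L. (cmod (K j s))\<^sup>2) = Re (K j j)"
  proof -
    have "of_real (\<Sum>s<L. (cmod (K j s))\<^sup>2) = (\<Sum>s<L. K j s * cnj (K j s))"
      by (simp only: of_real_sum complex_norm_square)
    also have "\<dots> = (\<Sum>s<L. K j s * K s j)"
      by (intro sum.cong refl) (simp add: herm[OF _ j(1)])
    finally show ?thesis using idem[of j j] j by (metis Re_complex_of_real)
  qed
  ultimately show ?thesis using j by (intro that[of j "K j"]) auto
qed

section \<open>One-sided filters of small Euclidean norm\<close>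

text \<open>Bounds the number of coarse steps uniformly over all root multisets of size \<open>d\<close>, hence independently of the
  sampling step, which changes the roots.\<close>

definition reach :: "nat \<Rightarrow> nat" where
  "reach d = nat \<lfloor>21 * real d ^ 2 * ln (2 * real d)\<rfloor>"

text \<open>Passes from a filter with coefficients indexed by an abstract set, with distinct delays, to one indexed by the delay.\<close>

lemma filter_reindex:
  fixes c :: "'i \<Rightarrow> complex"
  assumes "finite I" "inj_on off I" "off ` I \<subseteq> {..M}"
  obtains g :: "nat \<Rightarrow> complex"
  where "\<And>f. (\<Sum>k\<le>M. g k * f k) = (\<Sum>i\<in>I. c i * f (off i))"
    "(\<Sum>k\<le>M. (cmod (g k))\<^sup>2) = (\<Sum>i\<in>I. (cmod (c i))\<^sup>2)"
proof -
  define g where "g k = (if k \<in> off ` I then c (the_inv_into I off k) else 0)" for k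
  have g: "g (off i) = c i" if "i \<in> I" for i
    using that assms by (simp add: g_def the_inv_into_f_f)
  show ?thesis
  proof
    fix f
    have "(\<Sum>k\<le>M. g k * f k) = (\<Sum>k\<in>off ` I. g k * f k)"
      using assms by (intro sum.mono_neutral_right) (auto simp: g_def)
    also have "\<dots> = (\<Sum>i\<in>I. c i * f (off i))"
      using assms by (simp add: sum.reindex g)
    finally show "(\<Sum>k\<le>M. g k * f k) = (\<Sum>i\<in>I. c i * f (off i))" .
  next
    have "(\<Sum>k\<le>M. (cmod (g k))\<^sup>2) = (\<Sum>k\<in>off ` I. (cmod (g k))\<^sup>2)"
      using assms by (intro sum.mono_neutral_right) (auto simp: g_def)
    also have "\<dots> = (\<Sum>i\<in>I. (cmod (c i))\<^sup>2)"
      using assms by (simp add: sum.reindex g)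
    finally show "(\<Sum>k\<le>M. (cmod (g k))\<^sup>2) = (\<Sum>i\<in>I. (cmod (c i))\<^sup>2)" .
  qed
qed

text \<open>The coarse predictor acts on the signal sampled with step \<open>h\<close>, and every sample is replaced by the interior filter of
  length \<open>h\<close> around it. The delays \<open>k h + j - s\<close> are distinct, since \<open>s\<close> runs through \<open>h\<close> consecutive
  integers, and nonnegative, since \<open>k \<ge> 1\<close>. Hence the energy of the composite filter is the product of the two
  energies.\<close>

lemma one_sided_filter:
  assumes Z: "\<forall>z\<in>#Z. cmod z = 1" and d: "size Z = d" "d \<ge> 1" and h: "h \<ge> 1"
  obtains g where
    "\<And>x t. x \<in> exp_sums Z \<Longrightarrow> x t = (\<Sum>k\<le>(reach d + 1) * h. g k * x (t - int k))"
    "(\<Sum>k\<le>(reach d + 1) * h. (cmod (g k))\<^sup>2) \<le> 3 * real d / real h"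
proof -
  let ?Zh = "image_mset (\<lambda>z. z ^ h) Z"
  have "\<forall>z\<in>#?Zh. cmod z = 1" using Z by (auto simp: norm_power)
  then obtain Q where Q0: "coeff Q 0 = 0" and degQ: "real (degree Q) \<le> 21 * real d ^ 2 * ln (2 * real d)"
    and dvd: "root_poly ?Zh dvd 1 - Q" and energyQ: "(\<Sum>k\<le>degree Q. (cmod (coeff Q k))\<^sup>2) \<le> 3"
    using predictor_of_bounded_energy[of ?Zh d] d by auto
  have degQ': "degree Q \<le> reach d" unfolding reach_def using degQ by (simp add: le_nat_floor)
  have coarse: "x t = (\<Sum>k=1..degree Q. coeff Q k * x (t - int (k * h)))" if x: "x \<in> exp_sums Z" for x t
  proof -
    have "root_poly Z dvd pcompose (1 - Q) (monom 1 h)"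
    proof -
      obtain S where "1 - Q = root_poly ?Zh * S" using dvd by (rule dvdE)
      then show ?thesis
        using root_poly_dvd_dilate[of Z h] by (simp only: pcompose_mult dvd_mult2)
    qed
    then have "act (1 - pcompose Q (monom 1 h)) x t = 0"
      using act_dvd[OF _ x] by (simp add: pcompose_diff pcompose_1)
    then have "x t = (\<Sum>k\<le>degree Q. coeff Q k * x (t - int (k * h)))"
      by (simp add: act_diff act_pcompose_monom)
    also have "\<dots> = (\<Sum>k=1..degree Q. coeff Q k * x (t - int (k * h)))"
      using Q0 by (intro sum.mono_neutral_right) (auto simp: not_less_eq_eq)
    finally show ?thesis .
  qed
  have nz: "0 \<notin># Z" using Z by auto
  obtain j r where j: "j < h"
    and r: "\<And>x t. x \<in> exp_sums Z \<Longrightarrow> x (t + int j) = (\<Sum>s<h. r s * x (t + int s))"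
    and energyr: "(\<Sum>s<h. (cmod (r s))\<^sup>2) \<le> real d / real h"
    using interior_filter[OF nz h, unfolded d(1)] by blast
  define I where "I = {1..degree Q} \<times> {..<h}"
  define off where "off = (\<lambda>(k, s). k * h + j - s)"
  define c where "c = (\<lambda>(k, s). coeff Q k * r s)"
  have sle: "s \<le> k * h" if "(k, s) \<in> I" for k s
  proof -
    have "s \<le> 1 * h" using that by (auto simp: I_def)
    also have "\<dots> \<le> k * h" using that by (intro mult_right_mono) (auto simp: I_def)
    finally show ?thesis .
  qed
  have "inj_on off I"
  proof (rule inj_onI, clarify)
    fix k s k' s' assume I: "(k, s) \<in> I" "(k', s') \<in> I" and eq: "off (k, s) = off (k', s')"
    have "s' + k * h = s + k' * h" using eq sle[OF I(1)] sle[OF I(2)] by (auto simp: off_def)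
    moreover have "s < h" "s' < h" using I by (auto simp: I_def)
    ultimately have "s' = s" by (metis mod_less mod_mult_self1)
    then show "k = k' \<and> s = s'" using \<open>s' + k * h = s + k' * h\<close> h by simp
  qed
  moreover have "off ` I \<subseteq> {..(reach d + 1) * h}"
  proof -
    have "off (k, s) \<le> (reach d + 1) * h" if "(k, s) \<in> I" for k s
    proof -
      have "k * h \<le> reach d * h" using degQ' that by (intro mult_right_mono) (auto simp: I_def)
      then show ?thesis using j unfolding off_def prod.case distrib_right mult_1 by linarith
    qed
    then show ?thesis by auto
  qed
  ultimately obtain g where
    g: "\<And>f. (\<Sum>k\<le>(reach d + 1) * h. g k * f k) = (\<Sum>i\<in>I. c i * f (off i))"
    and energy: "(\<Sum>k\<le>(reach d + 1) * h. (cmod (g k))\<^sup>2) = (\<Sum>i\<in>I. (cmod (c i))\<^sup>2)"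
    using filter_reindex[of I off "(reach d + 1) * h" c] by (auto simp: I_def)
  show ?thesis
  proof
    fix x t assume x: "x \<in> exp_sums Z"
    have "x t = (\<Sum>k=1..degree Q. coeff Q k * (\<Sum>s<h. r s * x (t - int (k * h) - int j + int s)))"
      using coarse[OF x, of t] r[OF x, of "t - int (k * h) - int j" for k] by simp
    also have "\<dots> = (\<Sum>(k, s)\<in>I. coeff Q k * r s * x (t - int (k * h) - int j + int s))"
      unfolding I_def by (simp add: sum_distrib_left sum.cartesian_product mult.assoc)
    also have "\<dots> = (\<Sum>i\<in>I. c i * x (t - int (off i)))"
    proof (rule sum.cong[OF refl], clarify)
      fix k s assume "(k, s) \<in> I"
      then have "int (off (k, s)) = int (k * h) + int j - int s"
        using sle[of k s] by (simp add: off_def of_nat_diff)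
      then have "t - int (off (k, s)) = t - int (k * h) - int j + int s" by simp
      then show "coeff Q k * r s * x (t - int (k * h) - int j + int s) = c (k, s) * x (t - int (off (k, s)))"
        by (simp only: c_def prod.case)
    qed
    finally show "x t = (\<Sum>k\<le>(reach d + 1) * h. g k * x (t - int k))" by (simp only: g)
  next
    have "(\<Sum>i\<in>I. (cmod (c i))\<^sup>2) = (\<Sum>k=1..degree Q. (cmod (coeff Q k))\<^sup>2) * (\<Sum>s<h. (cmod (r s))\<^sup>2)"
      unfolding I_def c_def
      by (simp add: sum_product sum.cartesian_product norm_mult power_mult_distrib case_prod_beta)
    also have "\<dots> \<le> 3 * (real d / real h)"
    proof (rule mult_mono[OF _ energyr])
      show "(\<Sum>k=1..degree Q. (cmod (coeff Q k))\<^sup>2) \<le> 3"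
        using energyQ by (rule order.trans[rotated]) (intro sum_mono2, auto)
    qed (auto intro: sum_nonneg)
    finally show "(\<Sum>k\<le>(reach d + 1) * h. (cmod (g k))\<^sup>2) \<le> 3 * real d / real h"
      unfolding energy by simp
  qed
qed

section \<open>The discrete Fourier transform controls exponential sums uniformly\<close>

lemma finite_unity_roots: "N \<ge> 1 \<Longrightarrow> finite (unity_roots N)"
  unfolding unity_roots_def by (rule finite_roots_unity) simp

lemma card_unity_roots: "N \<ge> 1 \<Longrightarrow> card (unity_roots N) = N"
  unfolding unity_roots_def by (rule card_roots_unity_eq) simp

lemma norm_unity_root: "N \<ge> 1 \<Longrightarrow> \<mu> \<in> unity_roots N \<Longrightarrow> cmod \<mu> = 1"
  using power_eq_1_iff[of \<mu> N] by (auto simp: unity_roots_def)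

lemma unit_mult_cnj: "cmod z = 1 \<Longrightarrow> z * cnj z = 1"
  using complex_norm_square[of z] by simp

lemma one_in_unity_roots: "1 \<in> unity_roots N"
  by (simp add: unity_roots_def)

lemma sum_unity_roots_power:
  assumes N: "N \<ge> 1"
  shows "(\<Sum>\<mu>\<in>unity_roots N. \<mu> ^ k) = (if N dvd k then of_nat N else 0)"
proof (cases "N dvd k")
  case True
  then have "\<mu> ^ k = 1" if "\<mu> \<in> unity_roots N" for \<mu>
    using that by (auto simp: unity_roots_def power_mult)
  then show ?thesis using True by (simp add: card_unity_roots[OF N])
next
  case False
  define \<zeta> where "\<zeta> = exp (2 * of_real pi * \<i> * of_nat 1 / of_nat N)"
  have \<zeta>k: "\<zeta> ^ k = exp (2 * of_real pi * \<i> * of_nat k / of_nat N)"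
    unfolding \<zeta>_def by (simp add: exp_of_nat_mult[symmetric] mult_ac)
  have "\<zeta> ^ k \<noteq> 1"
    using complex_root_unity_eq_1[of N k] False N unfolding \<zeta>k by simp
  have \<zeta>N: "\<zeta> ^ N = 1" unfolding \<zeta>_def by (rule complex_root_unity) (use N in simp)
  have bij: "bij_betw (\<lambda>\<mu>. \<zeta> * \<mu>) (unity_roots N) (unity_roots N)"
    by (rule bij_betw_byWitness[of _ "\<lambda>\<mu>. \<mu> / \<zeta>"])
       (use \<zeta>N N in \<open>auto simp: unity_roots_def power_mult_distrib power_divide \<zeta>_def\<close>)
  have "(\<Sum>\<mu>\<in>unity_roots N. \<mu> ^ k) = (\<Sum>\<mu>\<in>unity_roots N. (\<zeta> * \<mu>) ^ k)"
    by (rule sum.reindex_bij_betw[OF bij, symmetric])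
  also have "\<dots> = \<zeta> ^ k * (\<Sum>\<mu>\<in>unity_roots N. \<mu> ^ k)"
    by (simp add: power_mult_distrib sum_distrib_left)
  finally show ?thesis using \<open>\<zeta> ^ k \<noteq> 1\<close> False by (metis mult_cancel_right1)
qed

lemma unity_roots_orthogonal:
  assumes N: "N \<ge> 1" and a: "a < N" and b: "b < N"
  shows "(\<Sum>\<mu>\<in>unity_roots N. \<mu> ^ a * cnj (\<mu> ^ b)) = (if a = b then of_nat N else 0)"
proof -
  have "\<mu> ^ a * cnj (\<mu> ^ b) = \<mu> ^ (a + (N - b))" if "\<mu> \<in> unity_roots N" for \<mu>
  proof -
    have "cmod (\<mu> ^ b) = 1" using norm_unity_root[OF N that] by (simp add: norm_power)
    then have "\<mu> ^ b * cnj (\<mu> ^ b) = 1" by (rule unit_mult_cnj)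
    moreover have "\<mu> ^ b * \<mu> ^ (N - b) = 1" using that b by (simp add: unity_roots_def flip: power_add)
    ultimately have "cnj (\<mu> ^ b) = \<mu> ^ (N - b)"
      by (metis mult.assoc mult.commute mult_1_left)
    then show ?thesis by (simp add: power_add)
  qed
  then have "(\<Sum>\<mu>\<in>unity_roots N. \<mu> ^ a * cnj (\<mu> ^ b)) = (\<Sum>\<mu>\<in>unity_roots N. \<mu> ^ (a + (N - b)))"
    by (intro sum.cong) auto
  also have "\<dots> = (if N dvd a + (N - b) then of_nat N else 0)"
    by (rule sum_unity_roots_power[OF N])
  also have "N dvd a + (N - b) \<longleftrightarrow> a = b"
  proof
    assume "N dvd a + (N - b)"
    then obtain k where k: "a + (N - b) = N * k" by (elim dvdE)
    have "0 < a + (N - b)" "a + (N - b) < N * 2" using a b by auto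
    then have "k = 1" unfolding k using N by simp
    then show "a = b" using k b by simp
  qed (use b in auto)
  finally show ?thesis .
qed

lemma powr_minus_half:
  assumes "N \<ge> 1"
  shows "real N powr (-1/2) = 1 / sqrt (real N)" "real N powr - (1/2) = 1 / sqrt (real N)"
  using assms by (simp_all add: powr_minus powr_half_sqrt field_simps)

lemma DFT_inversion:
  assumes N: "N \<ge> 1" and t: "t < N"
  shows "f t = of_real (real N powr (-1/2)) * (\<Sum>\<mu>\<in>unity_roots N. DFT N f \<mu> * cnj (\<mu> ^ t))"
proof -
  let ?c = "complex_of_real (real N powr (-1/2))"
  have c: "?c * ?c * of_nat N = 1"
  proof -
    have "real N powr (-1/2) * real N powr (-1/2) * real N = 1"
      using N by (simp add: powr_minus_half)
    then have "complex_of_real (real N powr (-1/2) * real N powr (-1/2) * real N) = 1"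
      by (simp only: of_real_1)
    then show ?thesis by (simp only: of_real_mult of_real_of_nat_eq)
  qed
  have "(\<Sum>\<mu>\<in>unity_roots N. DFT N f \<mu> * cnj (\<mu> ^ t))
      = (\<Sum>\<mu>\<in>unity_roots N. \<Sum>s<N. ?c * f s * (\<mu> ^ s * cnj (\<mu> ^ t)))"
    by (simp add: DFT_def sum_distrib_left sum_distrib_right mult_ac)
  also have "\<dots> = (\<Sum>s<N. ?c * f s * (\<Sum>\<mu>\<in>unity_roots N. \<mu> ^ s * cnj (\<mu> ^ t)))"
    by (subst sum.swap) (simp add: sum_distrib_left)
  also have "\<dots> = (\<Sum>s<N. ?c * f s * (if s = t then of_nat N else 0))"
    by (intro sum.cong refl) (simp only: unity_roots_orthogonal[OF N _ t] lessThan_iff)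
  also have "\<dots> = ?c * f t * of_nat N"
    using t by (simp add: if_distrib[of "\<lambda>a. _ * a"] cong: if_cong)
  finally have "?c * (\<Sum>\<mu>\<in>unity_roots N. DFT N f \<mu> * cnj (\<mu> ^ t)) = ?c * ?c * of_nat N * f t"
    by (simp only: mult_ac)
  then show ?thesis by (simp only: c mult_1_left)
qed

lemma unity_roots_parseval:
  assumes N: "N \<ge> 1" and M: "M < N"
  shows "(\<Sum>\<mu>\<in>unity_roots N. (cmod (\<Sum>k\<le>M. g k * \<mu> ^ k))\<^sup>2) = real N * (\<Sum>k\<le>M. (cmod (g k))\<^sup>2)"
proof -
  have "complex_of_real (\<Sum>\<mu>\<in>unity_roots N. (cmod (\<Sum>k\<le>M. g k * \<mu> ^ k))\<^sup>2)
      = (\<Sum>\<mu>\<in>unity_roots N. (\<Sum>k\<le>M. g k * \<mu> ^ k) * (\<Sum>l\<le>M. cnj (g l) * cnj (\<mu> ^ l)))"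
    by (simp only: of_real_sum complex_norm_square cnj_sum complex_cnj_mult)
  also have "\<dots> = (\<Sum>\<mu>\<in>unity_roots N. \<Sum>k\<le>M. \<Sum>l\<le>M. g k * cnj (g l) * (\<mu> ^ k * cnj (\<mu> ^ l)))"
    by (simp only: sum_product mult_ac)
  also have "\<dots> = (\<Sum>k\<le>M. \<Sum>l\<le>M. \<Sum>\<mu>\<in>unity_roots N. g k * cnj (g l) * (\<mu> ^ k * cnj (\<mu> ^ l)))"
    by (subst sum.swap, intro sum.cong refl, rule sum.swap)
  also have "\<dots> = (\<Sum>k\<le>M. \<Sum>l\<le>M. g k * cnj (g l) * (if k = l then of_nat N else 0))"
    using M by (intro sum.cong refl) (simp only: sum_distrib_left[symmetric], subst unity_roots_orthogonal[OF N], auto)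
  also have "\<dots> = (\<Sum>k\<le>M. g k * cnj (g k) * of_nat N)"
    by (intro sum.cong refl) (simp add: if_distrib[of "\<lambda>a. _ * a"] cong: if_cong)
  also have "\<dots> = complex_of_real (real N * (\<Sum>k\<le>M. (cmod (g k))\<^sup>2))"
    by (simp only: of_real_mult of_real_sum complex_norm_square sum_distrib_left of_real_of_nat_eq mult_ac)
  finally show ?thesis by (simp only: of_real_eq_iff)
qed

lemma DFT_le_norm:
  "N \<ge> 1 \<Longrightarrow> \<mu> \<in> unity_roots N \<Longrightarrow> cmod (DFT N f \<mu>) \<le> DFT_norm N f"
  unfolding DFT_norm_def by (intro Max_ge) (auto simp: finite_unity_roots)

lemma DFT_norm_nonneg: "N \<ge> 1 \<Longrightarrow> 0 \<le> DFT_norm N f"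
  using DFT_le_norm[OF _ one_in_unity_roots, of N f] norm_ge_zero order.trans by blast

lemma DFT_norm_le:
  assumes "N \<ge> 1" "\<And>\<mu>. \<mu> \<in> unity_roots N \<Longrightarrow> cmod (DFT N f \<mu>) \<le> B"
  shows "DFT_norm N f \<le> B"
  unfolding DFT_norm_def using assms one_in_unity_roots[of N]
  by (subst Max_le_iff) (auto simp: finite_unity_roots)

text \<open>The filter is applied twice in order that its transfer function \<open>G\<close> enters as \<open>G\<^sup>2\<close>: the sum of \<open>\<bar>G(\<mu>)\<bar>\<^sup>2\<close> over
  the roots of unity is governed by Parseval's identity, which would be unavailable for the sum of \<open>\<bar>G(\<mu>)\<bar>\<close>. The
  condition \<open>2 M \<le> t\<close> keeps all values in use inside the window.\<close>

lemma filtered_value_bound: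
  assumes N: "N \<ge> 1" and t: "t < N" and M: "2 * M \<le> t"
    and g: "\<And>t. x t = (\<Sum>k\<le>M. g k * x (t - int k))"
  shows "cmod (x (int t)) \<le> sqrt (real N) * (\<Sum>k\<le>M. (cmod (g k))\<^sup>2) * DFT_norm N (\<lambda>t. x (int t))"
proof -
  let ?U = "unity_roots N"
  let ?c = "complex_of_real (real N powr (-1/2))"
  let ?X = "DFT N (\<lambda>t. x (int t))"
  let ?F = "DFT_norm N (\<lambda>t. x (int t))"
  define G where "G \<mu> = (\<Sum>k\<le>M. g k * \<mu> ^ k)" for \<mu>
  have shift: "x (int t - int a - int b) = ?c * (\<Sum>\<mu>\<in>?U. ?X \<mu> * cnj (\<mu> ^ t) * \<mu> ^ a * \<mu> ^ b)"
    if "a \<le> M" "b \<le> M" for a b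
  proof -
    have ab: "a + b \<le> t" using that M by simp
    have "cnj (\<mu> ^ (t - (a + b))) = cnj (\<mu> ^ t) * \<mu> ^ a * \<mu> ^ b" if "\<mu> \<in> ?U" for \<mu>
    proof -
      have "cmod (\<mu> ^ (a + b)) = 1" using norm_unity_root[OF N that] by (simp add: norm_power)
      then have 1: "cnj (\<mu> ^ (a + b)) * \<mu> ^ (a + b) = 1" using unit_mult_cnj by (simp only: mult.commute)
      have "cnj (\<mu> ^ t) = cnj (\<mu> ^ (t - (a + b))) * cnj (\<mu> ^ (a + b))"
        using ab by (simp flip: complex_cnj_mult power_add)
      then have "cnj (\<mu> ^ t) * \<mu> ^ (a + b) = cnj (\<mu> ^ (t - (a + b))) * (cnj (\<mu> ^ (a + b)) * \<mu> ^ (a + b))"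
        by (simp only: mult.assoc)
      then have "cnj (\<mu> ^ (t - (a + b))) = cnj (\<mu> ^ t) * \<mu> ^ (a + b)" by (simp only: 1 mult_1_right)
      then show ?thesis by (simp only: power_add mult.assoc)
    qed
    moreover have "int t - int a - int b = int (t - (a + b))" using ab by (simp add: of_nat_diff)
    moreover have "t - (a + b) < N" using t by simp
    ultimately show ?thesis
      using DFT_inversion[OF N, of "t - (a + b)" "\<lambda>t. x (int t)"] by (simp add: mult.assoc)
  qed
  have swap: "(\<Sum>a\<le>M. \<Sum>b\<le>M. \<Sum>\<mu>\<in>?U. f a b \<mu>) = (\<Sum>\<mu>\<in>?U. \<Sum>a\<le>M. \<Sum>b\<le>M. f a b \<mu>)" for f :: "_ \<Rightarrow> _ \<Rightarrow> _ \<Rightarrow> complex"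
  proof -
    have "(\<Sum>a\<le>M. \<Sum>b\<le>M. \<Sum>\<mu>\<in>?U. f a b \<mu>) = (\<Sum>a\<le>M. \<Sum>\<mu>\<in>?U. \<Sum>b\<le>M. f a b \<mu>)"
      by (intro sum.cong refl) (rule sum.swap)
    also have "\<dots> = (\<Sum>\<mu>\<in>?U. \<Sum>a\<le>M. \<Sum>b\<le>M. f a b \<mu>)" by (rule sum.swap)
    finally show ?thesis .
  qed
  have "x (int t) = (\<Sum>a\<le>M. g a * (\<Sum>b\<le>M. g b * x (int t - int a - int b)))"
    by (subst g, intro sum.cong refl, subst g) simp
  also have "\<dots> = (\<Sum>a\<le>M. g a * (\<Sum>b\<le>M. g b * (?c * (\<Sum>\<mu>\<in>?U. ?X \<mu> * cnj (\<mu> ^ t) * \<mu> ^ a * \<mu> ^ b))))"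
    by (intro sum.cong refl arg_cong2[of _ _ _ _ "(*)"]) (simp add: shift)
  also have "\<dots> = (\<Sum>a\<le>M. \<Sum>b\<le>M. \<Sum>\<mu>\<in>?U. ?c * (?X \<mu> * cnj (\<mu> ^ t) * ((g a * \<mu> ^ a) * (g b * \<mu> ^ b))))"
    by (simp only: sum_distrib_left mult_ac)
  also have "\<dots> = (\<Sum>\<mu>\<in>?U. \<Sum>a\<le>M. \<Sum>b\<le>M. ?c * (?X \<mu> * cnj (\<mu> ^ t) * ((g a * \<mu> ^ a) * (g b * \<mu> ^ b))))"
    by (rule swap)
  also have "\<dots> = ?c * (\<Sum>\<mu>\<in>?U. ?X \<mu> * cnj (\<mu> ^ t) * (G \<mu>)\<^sup>2)"
    by (simp only: G_def power2_eq_square sum_product) (simp only: sum_distrib_left)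
  finally have "cmod (x (int t)) = real N powr (-1/2) * cmod (\<Sum>\<mu>\<in>?U. ?X \<mu> * cnj (\<mu> ^ t) * (G \<mu>)\<^sup>2)"
    by (simp add: norm_mult)
  also have "\<dots> \<le> real N powr (-1/2) * (\<Sum>\<mu>\<in>?U. ?F * (cmod (G \<mu>))\<^sup>2)"
  proof (intro mult_left_mono sum_norm_le)
    fix \<mu> assume "\<mu> \<in> ?U"
    then show "cmod (?X \<mu> * cnj (\<mu> ^ t) * (G \<mu>)\<^sup>2) \<le> ?F * (cmod (G \<mu>))\<^sup>2"
      using DFT_le_norm[OF N, of \<mu>] norm_unity_root[OF N, of \<mu>]
      by (simp add: norm_mult norm_power mult_right_mono)
  qed simp
  also have "\<dots> = real N powr (-1/2) * (real N * (\<Sum>k\<le>M. (cmod (g k))\<^sup>2) * ?F)"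
  proof -
    have "M < N" using M t by simp
    then show ?thesis
      by (simp only: G_def sum_distrib_left[symmetric] unity_roots_parseval[OF N]) (simp only: mult_ac)
  qed
  also have "\<dots> = sqrt (real N) * (\<Sum>k\<le>M. (cmod (g k))\<^sup>2) * ?F"
    using N by (simp add: powr_minus_half real_div_sqrt mult.assoc[symmetric])
  finally show ?thesis .
qed

lemma value_bound_trivial:
  assumes N: "N \<ge> 1" and t: "t < N"
  shows "cmod (f t) \<le> sqrt (real N) * DFT_norm N f"
proof -
  have "cmod (f t) = real N powr (-1/2) * cmod (\<Sum>\<mu>\<in>unity_roots N. DFT N f \<mu> * cnj (\<mu> ^ t))"
    by (subst DFT_inversion[OF N t]) (simp add: norm_mult)
  also have "\<dots> \<le> real N powr (-1/2) * (\<Sum>\<mu>\<in>unity_roots N. cmod (DFT N f \<mu> * cnj (\<mu> ^ t)))"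
    by (intro mult_left_mono norm_sum) simp
  also have "\<dots> \<le> real N powr (-1/2) * (\<Sum>\<mu>\<in>unity_roots N. DFT_norm N f)"
    using DFT_le_norm[OF N] norm_unity_root[OF N]
    by (intro mult_left_mono sum_mono) (auto simp: norm_mult norm_power)
  also have "\<dots> = sqrt (real N) * DFT_norm N f"
  proof -
    have "1 / sqrt (real N) * (real N * DFT_norm N f) = real N / sqrt (real N) * DFT_norm N f" by simp
    then show ?thesis using N by (simp only: card_unity_roots powr_minus_half real_div_sqrt sum_constant of_nat_0_le_iff)
  qed
  finally show ?thesis .
qed

lemma reach_le:
  assumes "d \<ge> 1"
  shows "real (reach d + 1) \<le> 23 * real d ^ 2 * ln (2 * real d)"
proof -
  have "1 * (2/3) \<le> real d ^ 2 * ln (2 * real d)"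
    using assms ln_double_ge[OF assms] by (intro mult_mono) auto
  moreover have "real (reach d) \<le> 21 * real d ^ 2 * ln (2 * real d)"
    using ln_double_ge[OF assms] unfolding reach_def by (intro of_nat_floor) auto
  ultimately show ?thesis by simp
qed

text \<open>The step \<open>h\<close> is taken as large as the condition \<open>2 R h \<le> t\<close> permits, so that it is of order \<open>N / R\<close>, where \<open>R\<close> is
  the number of coarse steps. If there is no room even for \<open>h = 1\<close>, then \<open>N\<close> is of order \<open>R\<close> at most and Fourier
  inversion alone is strong enough. Both cases are expressed by a number \<open>B\<close> that stands for the energy of the filter.\<close>

lemma exp_sums_bound_second_half:
  assumes Z: "\<forall>z\<in>#Z. cmod z = 1" and d: "size Z = d" "d \<ge> 1"
    and N: "N \<ge> 1" and t: "t < N" "N \<le> 2 * t + 1" and x: "x \<in> exp_sums Z"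
  shows "cmod (x (int t)) \<le> 828 * real d ^ 3 * ln (2 * real d) / sqrt (real N) * DFT_norm N (\<lambda>t. x (int t))"
proof -
  let ?F = "DFT_norm N (\<lambda>t. x (int t))"
  let ?L = "ln (2 * real d)"
  define R where "R = reach d + 1"
  have R: "real R \<le> 23 * real d ^ 2 * ?L" using reach_le[OF d(2)] by (simp add: R_def)
  have "real d \<ge> 1" using d by simp
  have F: "?F \<ge> 0" by (rule DFT_norm_nonneg[OF N])
  have "\<exists>B. cmod (x (int t)) \<le> sqrt (real N) * B * ?F \<and> real N * B \<le> 36 * real d * real R"
  proof (cases "2 * R \<le> t")
    case True
    define h where "h = t div (2 * R)"
    have R1: "R \<ge> 1" by (simp add: R_def)
    have h: "h \<ge> 1" using True R1 by (simp add: h_def div_greater_zero_iff Suc_le_eq)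
    have ht: "2 * (R * h) \<le> t" unfolding h_def using times_div_less_eq_dividend[of "2 * R" t] by (simp add: mult.assoc)
    have "t < 2 * R * (h + 1)" unfolding h_def using R1 by (simp add: dividend_less_times_div)
    also have "\<dots> \<le> 2 * R * (2 * h)" using h by (intro mult_left_mono) auto
    finally have "t \<le> 4 * R * h" by simp
    then have "N \<le> 12 * R * h" using t True R1 by simp
    then have Nh: "real N \<le> 12 * real R * real h" by (metis of_nat_le_iff of_nat_mult of_nat_numeral)
    obtain g where g: "\<And>x t. x \<in> exp_sums Z \<Longrightarrow> x t = (\<Sum>k\<le>R * h. g k * x (t - int k))"
      and energy: "(\<Sum>k\<le>R * h. (cmod (g k))\<^sup>2) \<le> 3 * real d / real h"
      using one_sided_filter[OF Z d h] unfolding R_def by blast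
    have "cmod (x (int t)) \<le> sqrt (real N) * (\<Sum>k\<le>R * h. (cmod (g k))\<^sup>2) * ?F"
      by (rule filtered_value_bound[OF N t(1) ht g[OF x]])
    also have "\<dots> \<le> sqrt (real N) * (3 * real d / real h) * ?F"
      using energy F by (intro mult_right_mono mult_left_mono) auto
    finally have "cmod (x (int t)) \<le> sqrt (real N) * (3 * real d / real h) * ?F" .
    moreover have "real N * (3 * real d / real h) \<le> 36 * real d * real R"
    proof -
      have "real N * (3 * real d / real h) \<le> 12 * real R * real h * (3 * real d / real h)"
        using Nh by (intro mult_right_mono) auto
      then show ?thesis using h by (simp add: field_simps)
    qed
    ultimately show ?thesis by blast
  next
    case False
    have "real N \<le> 4 * real R" using t False by linarith
    also have "\<dots> \<le> 36 * real d * real R"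
      using d by (intro mult_right_mono) auto
    finally have "real N * 1 \<le> 36 * real d * real R" by simp
    moreover have "cmod (x (int t)) \<le> sqrt (real N) * 1 * ?F"
      using value_bound_trivial[OF N t(1), of "\<lambda>t. x (int t)"] by simp
    ultimately show ?thesis by blast
  qed
  then obtain B where B: "cmod (x (int t)) \<le> sqrt (real N) * B * ?F" "real N * B \<le> 36 * real d * real R"
    by blast
  have "sqrt (real N) * B = real N * B / sqrt (real N)"
    using N by (simp add: field_simps)
  also have "\<dots> \<le> 828 * real d ^ 3 * ?L / sqrt (real N)"
  proof (rule divide_right_mono)
    have "36 * real d * real R \<le> 36 * real d * (23 * real d ^ 2 * ?L)"
      using R by (intro mult_left_mono) auto
    then show "real N * B \<le> 828 * real d ^ 3 * ?L"
      using B(2) by (simp add: power2_eq_square power3_eq_cube mult_ac)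
  qed simp
  finally have "sqrt (real N) * B * ?F \<le> 828 * real d ^ 3 * ?L / sqrt (real N) * ?F"
    using F by (rule mult_right_mono)
  with B(1) show ?thesis by linarith
qed

lemma DFT_norm_reverse:
  assumes N: "N \<ge> 1"
  shows "DFT_norm N (\<lambda>t. x (int N - 1 - int t)) \<le> DFT_norm N (\<lambda>t. x (int t))"
proof (rule DFT_norm_le[OF N])
  fix \<mu> assume \<mu>: "\<mu> \<in> unity_roots N"
  have pow: "\<mu> ^ t = \<mu> ^ (N - 1) * cnj \<mu> ^ (N - 1 - t)" if "t < N" for t
  proof -
    have "cmod (\<mu> ^ (N - 1 - t)) = 1" using norm_unity_root[OF N \<mu>] by (simp add: norm_power)
    then have 1: "\<mu> ^ (N - 1 - t) * cnj \<mu> ^ (N - 1 - t) = 1"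
      using unit_mult_cnj[of "\<mu> ^ (N - 1 - t)"] by simp
    have "\<mu> ^ (N - 1) = \<mu> ^ t * \<mu> ^ (N - 1 - t)" using that by (simp flip: power_add)
    then show ?thesis using 1 by (simp add: mult.assoc)
  qed
  have "(\<Sum>t<N. x (int N - 1 - int t) * \<mu> ^ t)
      = (\<Sum>t<N. \<mu> ^ (N - 1) * (x (int N - 1 - int t) * cnj \<mu> ^ (N - 1 - t)))"
    by (intro sum.cong refl, subst pow) (simp_all only: lessThan_iff mult_ac)
  also have "\<dots> = \<mu> ^ (N - 1) * (\<Sum>t<N. x (int N - 1 - int t) * cnj \<mu> ^ (N - 1 - t))"
    by (simp only: sum_distrib_left)
  also have "(\<Sum>t<N. x (int N - 1 - int t) * cnj \<mu> ^ (N - 1 - t)) = (\<Sum>s<N. x (int s) * cnj \<mu> ^ s)"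
    by (rule sum.reindex_bij_witness[of _ "\<lambda>s. N - 1 - s" "\<lambda>s. N - 1 - s"])
       (use N in \<open>auto simp: of_nat_diff algebra_simps\<close>)
  finally have "cmod (DFT N (\<lambda>t. x (int N - 1 - int t)) \<mu>) = cmod (DFT N (\<lambda>t. x (int t)) (cnj \<mu>))"
    using norm_unity_root[OF N \<mu>] by (simp add: DFT_def norm_mult norm_power)
  also have "cnj \<mu> \<in> unity_roots N" using \<mu> by (simp add: unity_roots_def flip: complex_cnj_power)
  then have "cmod (DFT N (\<lambda>t. x (int t)) (cnj \<mu>)) \<le> DFT_norm N (\<lambda>t. x (int t))"
    by (rule DFT_le_norm[OF N])
  finally show "cmod (DFT N (\<lambda>t. x (int N - 1 - int t)) \<mu>) \<le> DFT_norm N (\<lambda>t. x (int t))" .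
qed

text \<open>A time \<open>t\<close> in the first half of the window becomes a time in the second half after reversal of the window, which
  replaces the roots by their inverses and keeps the Fourier norm bounded by the old one.\<close>

theorem exp_sums_uniform_bound:
  assumes Z: "\<forall>z\<in>#Z. cmod z = 1" and d: "size Z = d" "d \<ge> 1"
    and N: "N \<ge> 1" and t: "t < N" and x: "x \<in> exp_sums Z"
  shows "cmod (x (int t)) \<le> 828 * real d ^ 3 * ln (2 * real d) / sqrt (real N) * DFT_norm N (\<lambda>t. x (int t))"
proof (cases "N \<le> 2 * t + 1")
  case True
  then show ?thesis by (rule exp_sums_bound_second_half[OF Z d N t _ x])
next
  case False
  let ?C = "828 * real d ^ 3 * ln (2 * real d) / sqrt (real N)"
  define y where "y s = x (int N - 1 - s)" for s
  define s where "s = N - 1 - t"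
  have "0 \<notin># Z" using Z by auto
  then have y: "y \<in> exp_sums (image_mset inverse Z)" unfolding y_def by (rule exp_sums_reverse[OF _ x])
  have Z': "\<forall>z\<in>#image_mset inverse Z. cmod z = 1" using Z by (auto simp: norm_inverse)
  have "cmod (y (int s)) \<le> ?C * DFT_norm N (\<lambda>t. y (int t))"
    by (rule exp_sums_bound_second_half[OF Z' _ d(2) N _ _ y]) (use d False t in \<open>auto simp: s_def\<close>)
  also have "\<dots> \<le> ?C * DFT_norm N (\<lambda>t. x (int t))"
    using DFT_norm_reverse[OF N, of x] ln_double_ge[OF d(2)] unfolding y_def
    by (intro mult_left_mono) auto
  also have "y (int s) = x (int t)" using t by (simp add: y_def s_def of_nat_diff)
  finally show ?thesis .
qed

section \<open>Linear forms of the Gaussian noise\<close>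

lemma prob_space_std_normal: "prob_space std_normal_distribution"
  by (rule prob_space_normal_density) simp

lemma prob_space_gauss_noise: "prob_space (gauss_noise N)"
  unfolding gauss_noise_def by (intro prob_space_PiM prob_space_std_normal)

lemma sets_gauss_noise [measurable_cong]: "sets (gauss_noise N) = sets (Rvec N)"
  unfolding gauss_noise_def Rvec_def by (intro sets_PiM_cong) auto

lemma measurable_coordinate_Rvec [measurable]: "t < N \<Longrightarrow> (\<lambda>y. y t) \<in> borel_measurable (Rvec N)"
  unfolding Rvec_def by (rule measurable_component_singleton) simp

lemma std_normal_mgf:
  "integrable std_normal_distribution (\<lambda>x. exp (a * x))"
  "(\<integral>x. exp (a * x) \<partial>std_normal_distribution) = exp (a\<^sup>2 / 2)"
proof -
  have eq: "std_normal_density x * exp (a * x) = exp (a\<^sup>2 / 2) * normal_density a 1 x" for x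
  proof -
    have "- x\<^sup>2 / 2 + a * x = a\<^sup>2 / 2 + - (x - a)\<^sup>2 / 2" by (simp add: power2_eq_square field_simps)
    then have "exp (- x\<^sup>2 / 2) * exp (a * x) = exp (a\<^sup>2 / 2) * exp (- (x - a)\<^sup>2 / 2)"
      by (simp only: exp_add[symmetric])
    then show ?thesis by (simp add: normal_density_def)
  qed
  show "integrable std_normal_distribution (\<lambda>x. exp (a * x))"
    by (subst integrable_density) (auto simp: eq)
  show "(\<integral>x. exp (a * x) \<partial>std_normal_distribution) = exp (a\<^sup>2 / 2)"
    by (subst integral_density) (auto simp: eq)
qed

definition linear_form :: "nat \<Rightarrow> (nat \<Rightarrow> real) \<Rightarrow> (nat \<Rightarrow> real) \<Rightarrow> real" where
  "linear_form N a \<xi> = (\<Sum>t<N. a t * \<xi> t)"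

lemma linear_form_measurable [measurable]: "linear_form N a \<in> borel_measurable (Rvec N)"
  unfolding linear_form_def by measurable

text \<open>The moment generating function is the only information on the Gaussian noise that is used for linear forms. It serves
  the upper and the lower bound on the quantile, and replaces the rotation invariance of the Gaussian distribution.\<close>

lemma linear_form_mgf:
  "integrable (gauss_noise N) (\<lambda>\<xi>. exp (linear_form N a \<xi>))"
  "(\<integral>\<xi>. exp (linear_form N a \<xi>) \<partial>gauss_noise N) = exp ((\<Sum>t<N. (a t)\<^sup>2) / 2)"
proof -
  interpret product_sigma_finite "\<lambda>_::nat. std_normal_distribution"
    using prob_space_std_normal by (simp add: product_sigma_finite_def prob_space_imp_sigma_finite)
  have eq: "exp (linear_form N a \<xi>) = (\<Prod>t\<in>{..<N}. exp (a t * \<xi> t))" for \<xi>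
    by (simp add: linear_form_def exp_sum)
  show "integrable (gauss_noise N) (\<lambda>\<xi>. exp (linear_form N a \<xi>))"
    unfolding eq gauss_noise_def by (intro product_integrable_prod std_normal_mgf) simp
  have "(\<integral>\<xi>. exp (linear_form N a \<xi>) \<partial>gauss_noise N)
      = (\<Prod>t\<in>{..<N}. \<integral>x. exp (a t * x) \<partial>std_normal_distribution)"
    unfolding eq gauss_noise_def by (intro product_integral_prod std_normal_mgf) simp
  then show "(\<integral>\<xi>. exp (linear_form N a \<xi>) \<partial>gauss_noise N) = exp ((\<Sum>t<N. (a t)\<^sup>2) / 2)"
    by (simp add: std_normal_mgf(2) exp_sum sum_divide_distrib)
qed

lemma linear_form_tail:
  assumes a: "(\<Sum>t<N. (a t)\<^sup>2) \<le> 1" and u: "u \<ge> 0"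
  shows "measure (gauss_noise N) {\<xi> \<in> space (gauss_noise N). u \<le> linear_form N a \<xi>} \<le> exp (- u\<^sup>2 / 2)"
proof -
  interpret prob_space "gauss_noise N" by (rule prob_space_gauss_noise)
  have eq: "linear_form N (\<lambda>t. u * a t) \<xi> = u * linear_form N a \<xi>" for \<xi>
    by (simp add: linear_form_def sum_distrib_left mult.assoc)
  have "measure (gauss_noise N) {\<xi> \<in> space (gauss_noise N). u \<le> linear_form N a \<xi>}
      \<le> measure (gauss_noise N) {\<xi> \<in> space (gauss_noise N). exp (u * u) \<le> exp (linear_form N (\<lambda>t. u * a t) \<xi>)}"
    using u by (intro finite_measure_mono) (auto simp: eq mult_left_mono)
  also have "\<dots> \<le> (\<integral>\<xi>. exp (linear_form N (\<lambda>t. u * a t) \<xi>) \<partial>gauss_noise N) / exp (u * u)"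
    by (intro integral_Markov_inequality_measure[of _ _ "{}"] linear_form_mgf) auto
  also have "\<dots> = exp (u\<^sup>2 * (\<Sum>t<N. (a t)\<^sup>2) / 2 - u\<^sup>2)"
    by (simp add: linear_form_mgf power_mult_distrib sum_distrib_left exp_diff power2_eq_square mult_ac)
  also have "\<dots> \<le> exp (- u\<^sup>2 / 2)"
    using mult_left_mono[OF a, of "u\<^sup>2"] by simp
  finally show ?thesis .
qed

lemma linear_form_abs_tail:
  assumes a: "(\<Sum>t<N. (a t)\<^sup>2) \<le> 1" and u: "u \<ge> 0"
  shows "measure (gauss_noise N) {\<xi> \<in> space (gauss_noise N). u \<le> \<bar>linear_form N a \<xi>\<bar>} \<le> 2 * exp (- u\<^sup>2 / 2)"
proof -
  interpret prob_space "gauss_noise N" by (rule prob_space_gauss_noise)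
  have neg: "linear_form N (\<lambda>t. - a t) \<xi> = - linear_form N a \<xi>" for \<xi>
    by (simp add: linear_form_def sum_negf)
  have "measure (gauss_noise N) {\<xi> \<in> space (gauss_noise N). u \<le> \<bar>linear_form N a \<xi>\<bar>}
      \<le> measure (gauss_noise N) ({\<xi> \<in> space (gauss_noise N). u \<le> linear_form N a \<xi>}
          \<union> {\<xi> \<in> space (gauss_noise N). u \<le> linear_form N (\<lambda>t. - a t) \<xi>})"
    by (intro finite_measure_mono) (auto simp: neg)
  also have "\<dots> \<le> measure (gauss_noise N) {\<xi> \<in> space (gauss_noise N). u \<le> linear_form N a \<xi>}
      + measure (gauss_noise N) {\<xi> \<in> space (gauss_noise N). u \<le> linear_form N (\<lambda>t. - a t) \<xi>}"
    by (intro measure_Un_le) auto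
  also have "\<dots> \<le> exp (- u\<^sup>2 / 2) + exp (- u\<^sup>2 / 2)"
    using linear_form_tail[OF a u] linear_form_tail[of "\<lambda>t. - a t" N u] a u
    by (intro add_mono) auto
  finally show ?thesis by simp
qed

section \<open>The quantile of the Fourier norm of the noise\<close>

definition fourier_norm :: "nat \<Rightarrow> (nat \<Rightarrow> real) \<Rightarrow> real" where
  "fourier_norm N y = DFT_norm N (\<lambda>t. complex_of_real (y t))"

text \<open>For real \<open>y\<close> the real and imaginary parts of the Fourier coefficient at \<open>\<mu>\<close> are linear forms in \<open>y\<close>
  with these coefficient vectors.\<close>

definition re_coeff :: "nat \<Rightarrow> complex \<Rightarrow> nat \<Rightarrow> real" where
  "re_coeff N \<mu> t = real N powr (-1/2) * Re (\<mu> ^ t)"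

definition im_coeff :: "nat \<Rightarrow> complex \<Rightarrow> nat \<Rightarrow> real" where
  "im_coeff N \<mu> t = real N powr (-1/2) * Im (\<mu> ^ t)"

lemma DFT_real_parts:
  "Re (DFT N (\<lambda>t. complex_of_real (y t)) \<mu>) = linear_form N (re_coeff N \<mu>) y"
  "Im (DFT N (\<lambda>t. complex_of_real (y t)) \<mu>) = linear_form N (im_coeff N \<mu>) y"
  by (simp_all add: DFT_def linear_form_def re_coeff_def im_coeff_def sum_distrib_left mult_ac)

lemma fourier_norm_measurable [measurable]:
  assumes N: "N \<ge> 1"
  shows "fourier_norm N \<in> borel_measurable (Rvec N)"
  unfolding fourier_norm_def DFT_norm_def cmod_def DFT_real_parts
  by (intro borel_measurable_Max finite_unity_roots[OF N]) measurable

lemma coeff_energy: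
  assumes N: "N \<ge> 1" and \<mu>: "\<mu> \<in> unity_roots N"
  shows "(\<Sum>t<N. (re_coeff N \<mu> t)\<^sup>2) + (\<Sum>t<N. (im_coeff N \<mu> t)\<^sup>2) = 1"
proof -
  have "(re_coeff N \<mu> t)\<^sup>2 + (im_coeff N \<mu> t)\<^sup>2 = 1 / real N" for t
  proof -
    have "(re_coeff N \<mu> t)\<^sup>2 + (im_coeff N \<mu> t)\<^sup>2 = (real N powr (-1/2))\<^sup>2 * (cmod (\<mu> ^ t))\<^sup>2"
      unfolding re_coeff_def im_coeff_def cmod_power2 by (simp add: power_mult_distrib distrib_left)
    also have "\<dots> = 1 / real N"
      using norm_unity_root[OF N \<mu>] N by (simp add: powr_minus_half norm_power power_divide)
    finally show ?thesis .
  qed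
  then show ?thesis using N by (simp flip: sum.distrib)
qed

text \<open>If the Fourier norm exceeds \<open>s\<close>, then at some frequency the real or the imaginary part is at least \<open>s / sqrt 2\<close> in
  absolute value. These are \<open>2 N\<close> events, each of probability at most \<open>2 exp (- s\<^sup>2 / 4)\<close>.\<close>

lemma fourier_norm_tail:
  assumes N: "N \<ge> 1" and s: "s \<ge> 0"
  shows "measure (gauss_noise N) {\<xi> \<in> space (gauss_noise N). s < fourier_norm N \<xi>} \<le> 4 * real N * exp (- s\<^sup>2 / 4)"
proof -
  interpret prob_space "gauss_noise N" by (rule prob_space_gauss_noise)
  let ?U = "unity_roots N"
  let ?P = "measure (gauss_noise N)"
  define E where "E a = {\<xi> \<in> space (gauss_noise N). s / sqrt 2 \<le> \<bar>linear_form N a \<xi>\<bar>}" for a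
  have [measurable]: "E a \<in> sets (gauss_noise N)" for a unfolding E_def by measurable
  have sq: "(s / sqrt 2)\<^sup>2 = s\<^sup>2 / 2" by (simp add: power_divide)
  have incl: "{\<xi> \<in> space (gauss_noise N). s < fourier_norm N \<xi>}
      \<subseteq> (\<Union>\<mu>\<in>?U. E (re_coeff N \<mu>) \<union> E (im_coeff N \<mu>))"
  proof
    fix \<xi> assume \<xi>: "\<xi> \<in> {\<xi> \<in> space (gauss_noise N). s < fourier_norm N \<xi>}"
    show "\<xi> \<in> (\<Union>\<mu>\<in>?U. E (re_coeff N \<mu>) \<union> E (im_coeff N \<mu>))"
    proof (rule ccontr)
      assume neg: "\<not> ?thesis"
      have "cmod (DFT N (\<lambda>t. complex_of_real (\<xi> t)) \<mu>) \<le> s" if \<mu>: "\<mu> \<in> ?U" for \<mu>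
      proof -
        have "\<bar>linear_form N (re_coeff N \<mu>) \<xi>\<bar> \<le> s / sqrt 2" "\<bar>linear_form N (im_coeff N \<mu>) \<xi>\<bar> \<le> s / sqrt 2"
          using neg \<mu> \<xi> by (auto simp: E_def)
        then have "(linear_form N (re_coeff N \<mu>) \<xi>)\<^sup>2 \<le> s\<^sup>2 / 2" "(linear_form N (im_coeff N \<mu>) \<xi>)\<^sup>2 \<le> s\<^sup>2 / 2"
          unfolding sq[symmetric] using s by (auto simp: abs_le_square_iff[symmetric])
        then have "(cmod (DFT N (\<lambda>t. complex_of_real (\<xi> t)) \<mu>))\<^sup>2 \<le> s\<^sup>2"
          unfolding cmod_power2 DFT_real_parts by simp
        then show ?thesis using s by (rule power2_le_imp_le)
      qed
      then have "fourier_norm N \<xi> \<le> s" unfolding fourier_norm_def by (rule DFT_norm_le[OF N])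
      with \<xi> show False by simp
    qed
  qed
  have each: "?P (E (re_coeff N \<mu>) \<union> E (im_coeff N \<mu>)) \<le> 4 * exp (- s\<^sup>2 / 4)" if \<mu>: "\<mu> \<in> ?U" for \<mu>
  proof -
    have tail: "?P (E a) \<le> 2 * exp (- s\<^sup>2 / 4)" if "(\<Sum>t<N. (a t)\<^sup>2) \<le> 1" for a
      using linear_form_abs_tail[OF that, of "s / sqrt 2"] s unfolding E_def sq by simp
    have "(\<Sum>t<N. (re_coeff N \<mu> t)\<^sup>2) \<le> 1" "(\<Sum>t<N. (im_coeff N \<mu> t)\<^sup>2) \<le> 1"
      using coeff_energy[OF N \<mu>] sum_nonneg[of "{..<N}" "\<lambda>t. (re_coeff N \<mu> t)\<^sup>2"]
        sum_nonneg[of "{..<N}" "\<lambda>t. (im_coeff N \<mu> t)\<^sup>2"] by auto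
    then have "?P (E (re_coeff N \<mu>)) + ?P (E (im_coeff N \<mu>)) \<le> 4 * exp (- s\<^sup>2 / 4)"
      using tail[of "re_coeff N \<mu>"] tail[of "im_coeff N \<mu>"] by simp
    then show ?thesis
      using measure_Un_le[of "E (re_coeff N \<mu>)" "gauss_noise N" "E (im_coeff N \<mu>)"] by simp
  qed
  have "?P {\<xi> \<in> space (gauss_noise N). s < fourier_norm N \<xi>} \<le> ?P (\<Union>\<mu>\<in>?U. E (re_coeff N \<mu>) \<union> E (im_coeff N \<mu>))"
    using finite_unity_roots[OF N] by (intro finite_measure_mono[OF incl]) auto
  also have "\<dots> \<le> (\<Sum>\<mu>\<in>?U. ?P (E (re_coeff N \<mu>) \<union> E (im_coeff N \<mu>)))"
    using finite_unity_roots[OF N] by (intro measure_UNION_le) auto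
  also have "\<dots> \<le> (\<Sum>\<mu>\<in>?U. 4 * exp (- s\<^sup>2 / 4))" by (intro sum_mono each)
  also have "\<dots> = 4 * real N * exp (- s\<^sup>2 / 4)" by (simp add: card_unity_roots[OF N])
  finally show ?thesis .
qed

text \<open>The sum of the real and imaginary parts of the Fourier coefficient at \<open>\<mu>\<close> is the Hartley transform of the noise. Its
  coefficient vectors \<open>a \<mu>\<close> are orthonormal, so the \<open>N\<close> forms behave like independent standard Gaussian variables
  and the maximum should be of order \<open>sqrt (ln N)\<close>; the event that is needed has probability exceeding \<open>\<alpha>\<close>, which
  may be small, and this is what raises the order to \<open>sqrt (ln (N/\<alpha>))\<close>. The proof is a second moment argument
  for \<open>Z = \<Sum>\<^sub>\<mu> exp (\<kappa> \<langle>a \<mu>, \<xi>\<rangle>)\<close> with mean \<open>m\<close>. Orthogonality gives variance at most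
  \<open>r m\<^sup>2\<close> with \<open>r = exp (\<kappa>\<^sup>2) / N\<close>, and so \<open>Z > m / 2\<close> with probability at least \<open>1 / (4 r + 1)\<close>. Taking
  \<open>r = 1 / (8 \<alpha>)\<close> makes this more than \<open>\<alpha>\<close>, whereas \<open>Z \<le> m / 2\<close> if all forms are at most \<open>\<kappa> / 4\<close>.\<close>

lemma small_ball_large_ratio:
  assumes N: "N \<ge> 1" and \<alpha>: "0 < \<alpha>" "\<alpha> < 1/2" and large: "real N / \<alpha> \<ge> 128"
  shows "measure (gauss_noise N) {\<xi> \<in> space (gauss_noise N). fourier_norm N \<xi> \<le> sqrt (ln (real N / \<alpha>)) / 40} < 1 - \<alpha>"
proof -
  interpret prob_space "gauss_noise N" by (rule prob_space_gauss_noise)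
  let ?U = "unity_roots N"
  define \<kappa> where "\<kappa> = sqrt (ln (real N / (8 * \<alpha>)))"
  define r where "r = 1 / (8 * \<alpha>)"
  define m where "m = real N * exp (\<kappa>\<^sup>2 / 2)"
  define a where "a \<mu> t = re_coeff N \<mu> t + im_coeff N \<mu> t" for \<mu> t
  define Z where "Z \<xi> = (\<Sum>\<mu>\<in>?U. exp (linear_form N (\<lambda>t. \<kappa> * a \<mu> t) \<xi>))" for \<xi>
  have r: "r > 0" using \<alpha> by (simp add: r_def)
  have big: "16 \<le> real N / (8 * \<alpha>)" using large by (simp add: field_simps)
  have \<kappa>2: "\<kappa>\<^sup>2 = ln (real N / (8 * \<alpha>))" using big by (simp add: \<kappa>_def)
  have \<kappa>0: "\<kappa> \<ge> 0" using big by (simp add: \<kappa>_def)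
  have exp\<kappa>: "exp (\<kappa>\<^sup>2) = real N * r" using big N \<alpha> by (simp add: \<kappa>2 r_def)
  have m: "m > 0" using N by (simp add: m_def)
  have orth: "(\<Sum>t<N. a \<mu> t * a \<nu> t) = (if \<mu> = \<nu> then 1 else 0)" if \<mu>: "\<mu> \<in> ?U" and \<nu>: "\<nu> \<in> ?U" for \<mu> \<nu>
  proof -
    have geo: "(\<Sum>t<N. w ^ t) = (if w = 1 then of_nat N else 0)" if "w ^ N = 1" for w :: complex
      using that by (auto simp: geometric_sum)
    \<comment> \<open>The addition formula \<open>cas x cas y = cos (x - y) + sin (x + y)\<close> for \<open>cas = cos + sin\<close>.\<close>
    have "a \<mu> t * a \<nu> t = (Re ((\<mu> * cnj \<nu>) ^ t) + Im ((\<mu> * \<nu>) ^ t)) / real N" for t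
    proof -
      have "a \<mu> t * a \<nu> t = (real N powr (-1/2))\<^sup>2 * ((Re (\<mu> ^ t) + Im (\<mu> ^ t)) * (Re (\<nu> ^ t) + Im (\<nu> ^ t)))"
        by (simp add: a_def re_coeff_def im_coeff_def power2_eq_square algebra_simps)
      also have "(real N powr (-1/2))\<^sup>2 = 1 / real N" using N by (simp add: powr_minus_half power_divide)
      also have "(Re (\<mu> ^ t) + Im (\<mu> ^ t)) * (Re (\<nu> ^ t) + Im (\<nu> ^ t)) = Re ((\<mu> * cnj \<nu>) ^ t) + Im ((\<mu> * \<nu>) ^ t)"
        by (simp add: power_mult_distrib algebra_simps flip: complex_cnj_power)
      finally show ?thesis by simp
    qed
    then have "(\<Sum>t<N. a \<mu> t * a \<nu> t) = (Re (\<Sum>t<N. (\<mu> * cnj \<nu>) ^ t) + Im (\<Sum>t<N. (\<mu> * \<nu>) ^ t)) / real N"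
      by (simp only: sum_divide_distrib[symmetric] sum.distrib Re_sum Im_sum)
    moreover have "(\<mu> * cnj \<nu>) ^ N = 1" "(\<mu> * \<nu>) ^ N = 1"
      using \<mu> \<nu> by (simp_all add: unity_roots_def power_mult_distrib flip: complex_cnj_power)
    moreover have "\<mu> * cnj \<nu> = 1 \<longleftrightarrow> \<mu> = \<nu>"
    proof -
      have u: "\<nu> * cnj \<nu> = 1" by (rule unit_mult_cnj[OF norm_unity_root[OF N \<nu>]])
      then have "cnj \<nu> \<noteq> 0" by auto
      then show ?thesis using u by (metis mult_right_cancel)
    qed
    ultimately show ?thesis using N by (auto simp: geo)
  qed
  have aenergy: "(\<Sum>t<N. (a \<mu> t + a \<nu> t)\<^sup>2) = (if \<mu> = \<nu> then 4 else 2)" if "\<mu> \<in> ?U" "\<nu> \<in> ?U" for \<mu> \<nu>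
  proof -
    have "(\<Sum>t<N. (a \<mu> t + a \<nu> t)\<^sup>2) = (\<Sum>t<N. a \<mu> t * a \<mu> t) + 2 * (\<Sum>t<N. a \<mu> t * a \<nu> t) + (\<Sum>t<N. a \<nu> t * a \<nu> t)"
      by (simp add: power2_eq_square algebra_simps sum.distrib sum_distrib_left)
    then show ?thesis using that by (simp add: orth)
  qed
  have Zsq: "(Z \<xi>)\<^sup>2 = (\<Sum>\<mu>\<in>?U. \<Sum>\<nu>\<in>?U. exp (linear_form N (\<lambda>t. \<kappa> * (a \<mu> t + a \<nu> t)) \<xi>))" for \<xi>
    unfolding Z_def power2_eq_square sum_product exp_add[symmetric]
    by (simp add: linear_form_def algebra_simps sum.distrib)
  have intZ: "integrable (gauss_noise N) Z" unfolding Z_def by (intro Bochner_Integration.integrable_sum linear_form_mgf)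
  have intZ2: "integrable (gauss_noise N) (\<lambda>\<xi>. (Z \<xi>)\<^sup>2)"
    unfolding Zsq by (intro Bochner_Integration.integrable_sum linear_form_mgf)
  have EZ: "expectation Z = m"
  proof -
    have "expectation Z = (\<Sum>\<mu>\<in>?U. exp ((\<Sum>t<N. (\<kappa> * a \<mu> t)\<^sup>2) / 2))"
      unfolding Z_def by (subst Bochner_Integration.integral_sum) (auto simp: linear_form_mgf)
    also have "\<dots> = (\<Sum>\<mu>\<in>?U. exp (\<kappa>\<^sup>2 / 2))"
    proof (intro sum.cong refl)
      fix \<mu> assume "\<mu> \<in> ?U"
      then have "(\<Sum>t<N. (\<kappa> * a \<mu> t)\<^sup>2) = \<kappa>\<^sup>2"
        using orth[of \<mu> \<mu>] by (simp add: power_mult_distrib power2_eq_square[of "a _ _"] flip: sum_distrib_left)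
      then show "exp ((\<Sum>t<N. (\<kappa> * a \<mu> t)\<^sup>2) / 2) = exp (\<kappa>\<^sup>2 / 2)" by simp
    qed
    finally show ?thesis by (simp add: card_unity_roots[OF N] m_def)
  qed
  have EZ2: "expectation (\<lambda>\<xi>. (Z \<xi>)\<^sup>2) \<le> m\<^sup>2 * (r + 1)"
  proof -
    have "expectation (\<lambda>\<xi>. (Z \<xi>)\<^sup>2)
        = (\<Sum>\<mu>\<in>?U. \<Sum>\<nu>\<in>?U. exp ((\<Sum>t<N. (\<kappa> * (a \<mu> t + a \<nu> t))\<^sup>2) / 2))"
      unfolding Zsq
      by (subst Bochner_Integration.integral_sum, intro Bochner_Integration.integrable_sum linear_form_mgf, intro sum.cong refl,
          subst Bochner_Integration.integral_sum) (auto simp: linear_form_mgf)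
    also have "\<dots> \<le> (\<Sum>\<mu>\<in>?U. \<Sum>\<nu>\<in>?U. (if \<mu> = \<nu> then exp (2 * \<kappa>\<^sup>2) else 0) + exp (\<kappa>\<^sup>2))"
    proof (intro sum_mono)
      fix \<mu> \<nu> assume "\<mu> \<in> ?U" "\<nu> \<in> ?U"
      then have "(\<Sum>t<N. (\<kappa> * (a \<mu> t + a \<nu> t))\<^sup>2) = \<kappa>\<^sup>2 * (if \<mu> = \<nu> then 4 else 2)"
        using aenergy[of \<mu> \<nu>] by (simp only: power_mult_distrib sum_distrib_left[symmetric])
      then show "exp ((\<Sum>t<N. (\<kappa> * (a \<mu> t + a \<nu> t))\<^sup>2) / 2) \<le> (if \<mu> = \<nu> then exp (2 * \<kappa>\<^sup>2) else 0) + exp (\<kappa>\<^sup>2)"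
        by simp
    qed
    also have "\<dots> = real N * exp (2 * \<kappa>\<^sup>2) + real N * (real N * exp (\<kappa>\<^sup>2))"
      by (simp add: sum.distrib finite_unity_roots[OF N] card_unity_roots[OF N] distrib_left)
    also have "exp (2 * \<kappa>\<^sup>2) = exp (\<kappa>\<^sup>2) * exp (\<kappa>\<^sup>2)" by (simp flip: exp_add)
    also have "real N * (exp (\<kappa>\<^sup>2) * exp (\<kappa>\<^sup>2)) + real N * (real N * exp (\<kappa>\<^sup>2)) = real N * real N * exp (\<kappa>\<^sup>2) * (r + 1)"
      using exp\<kappa> by (simp add: algebra_simps)
    also have "real N * real N * exp (\<kappa>\<^sup>2) = m\<^sup>2"
      by (simp add: m_def power2_eq_square mult_ac flip: exp_add)
    finally show ?thesis .
  qed
  define c where "c = 2 * m * (r + 1/4)"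
  have c: "c > 0" using m r by (simp add: c_def)
  let ?A = "{\<xi> \<in> space (gauss_noise N). m / 2 < Z \<xi>}"
  have [measurable]: "Z \<in> borel_measurable (gauss_noise N)" using intZ by (rule borel_measurable_integrable)
  have prob: "prob ?A > \<alpha>"
  proof -
    \<comment> \<open>The quadratic function \<open>2 v / c - v\<^sup>2 / c\<^sup>2\<close> of \<open>v = Z - m / 2\<close> is at most \<open>1\<close> everywhere and at most \<open>0\<close> for \<open>v \<le> 0\<close>; the value of \<open>c\<close> maximizes the resulting lower bound on the probability.\<close>
    let ?u = "\<lambda>\<xi>. 2 * (Z \<xi> - m / 2) / c - (Z \<xi> - m / 2)\<^sup>2 / c\<^sup>2"
    have u: "?u \<xi> = (2 / c + m / c\<^sup>2) * Z \<xi> - (Z \<xi>)\<^sup>2 / c\<^sup>2 - (m / c + m\<^sup>2 / (4 * c\<^sup>2))" for \<xi>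
      using c by (simp add: field_simps power2_eq_square)
    have "expectation ?u = (2 / c + m / c\<^sup>2) * m - expectation (\<lambda>\<xi>. (Z \<xi>)\<^sup>2) / c\<^sup>2 - (m / c + m\<^sup>2 / (4 * c\<^sup>2))"
      unfolding u using intZ intZ2 by (simp add: EZ prob_space)
    moreover have "expectation (\<lambda>\<xi>. (Z \<xi>)\<^sup>2) / c\<^sup>2 \<le> m\<^sup>2 * (r + 1) / c\<^sup>2"
      by (intro divide_right_mono EZ2) simp
    ultimately have "(2 / c + m / c\<^sup>2) * m - m\<^sup>2 * (r + 1) / c\<^sup>2 - (m / c + m\<^sup>2 / (4 * c\<^sup>2)) \<le> expectation ?u"
      by linarith
    also have "expectation ?u \<le> expectation (indicator ?A)"
    proof (rule integral_mono)
      show "integrable (gauss_noise N) ?u" unfolding u using intZ intZ2 by simp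
      show "integrable (gauss_noise N) (indicator ?A :: _ \<Rightarrow> real)" by (simp add: integrable_indicator_iff emeasure_eq_measure)
      fix \<xi> assume \<xi>: "\<xi> \<in> space (gauss_noise N)"
      show "?u \<xi> \<le> indicator ?A \<xi>"
      proof (cases "m / 2 < Z \<xi>")
        case True
        have "0 \<le> ((Z \<xi> - m / 2) / c - 1)\<^sup>2" by simp
        also have "\<dots> = 1 - ?u \<xi>" by (simp add: power2_diff power_divide)
        finally show ?thesis using True \<xi> by simp
      next
        case False
        then have "2 * (Z \<xi> - m / 2) / c \<le> 0" using c by (simp add: divide_nonpos_pos)
        then show ?thesis using False by (simp add: add_increasing2 diff_le_eq order.trans)
      qed
    qed
    also have "expectation (indicator ?A) = prob ?A" by simp
    also have "(2 / c + m / c\<^sup>2) * m - m\<^sup>2 * (r + 1) / c\<^sup>2 - (m / c + m\<^sup>2 / (4 * c\<^sup>2)) = m / c - m\<^sup>2 * (r + 1/4) / c\<^sup>2"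
      using c by (simp add: field_simps power2_eq_square)
    also have "\<dots> = 1 / (4 * r + 1)"
    proof -
      define k where "k = r + 1/4"
      have "k > 0" using r by (simp add: k_def)
      have "m / c - m\<^sup>2 * k / c\<^sup>2 = 1 / (4 * k)"
        using \<open>k > 0\<close> m by (simp add: c_def k_def[symmetric] field_simps power2_eq_square)
      moreover have "4 * k = 4 * r + 1" by (simp add: k_def)
      ultimately show ?thesis unfolding k_def by (simp only:)
    qed
    finally have "1 / (4 * r + 1) \<le> prob ?A" .
    moreover have "\<alpha> < 1 / (4 * r + 1)"
      using \<alpha> by (simp add: r_def field_simps)
    ultimately show ?thesis by simp
  qed
  have small: "Z \<xi> \<le> m / 2" if "fourier_norm N \<xi> \<le> sqrt (ln (real N / \<alpha>)) / 40" for \<xi>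
  proof -
    have bound: "sqrt (ln (real N / \<alpha>)) / 40 \<le> \<kappa> / (4 * sqrt 2)"
    proof -
      have "ln (real N / \<alpha>) \<le> 50 * ln (real N / (8 * \<alpha>))"
      proof -
        have "ln (real N / \<alpha>) = ln 8 + ln (real N / (8 * \<alpha>))"
        proof -
          have "ln (real N / \<alpha>) = ln (8 * (real N / (8 * \<alpha>)))" by simp
          also have "\<dots> = ln 8 + ln (real N / (8 * \<alpha>))"
            by (rule ln_mult_pos) (use big in linarith)+
          finally show ?thesis .
        qed
        also have "ln 8 \<le> ln (real N / (8 * \<alpha>))" using big by (intro ln_mono) auto
        finally have "ln (real N / \<alpha>) \<le> 2 * ln (real N / (8 * \<alpha>))" by simp
        moreover have "0 \<le> ln (real N / (8 * \<alpha>))" using big by simp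
        ultimately show ?thesis by linarith
      qed
      then have "sqrt (ln (real N / \<alpha>)) \<le> sqrt (50 * ln (real N / (8 * \<alpha>)))" by simp
      also have "\<dots> = sqrt 50 * \<kappa>" by (simp add: \<kappa>_def real_sqrt_mult)
      also have "sqrt 50 = 10 / sqrt 2"
        by (rule real_sqrt_unique) (auto simp: power_divide)
      finally show ?thesis by simp
    qed
    have "exp (linear_form N (\<lambda>t. \<kappa> * a \<mu> t) \<xi>) \<le> exp (\<kappa>\<^sup>2 / 4)" if \<mu>: "\<mu> \<in> ?U" for \<mu>
    proof -
      let ?D = "DFT N (\<lambda>t. complex_of_real (\<xi> t)) \<mu>"
      have "linear_form N (\<lambda>t. \<kappa> * a \<mu> t) \<xi> = \<kappa> * (Re ?D + Im ?D)"
        unfolding DFT_real_parts by (simp add: linear_form_def a_def sum_distrib_left sum.distrib algebra_simps)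
      also have "Re ?D + Im ?D \<le> sqrt 2 * cmod ?D"
      proof -
        have "0 \<le> (Re ?D - Im ?D)\<^sup>2" by simp
        then have "(Re ?D + Im ?D)\<^sup>2 \<le> 2 * (cmod ?D)\<^sup>2"
          unfolding cmod_power2 by (simp add: power2_sum power2_diff)
        then have "(Re ?D + Im ?D)\<^sup>2 \<le> (sqrt 2 * cmod ?D)\<^sup>2" by (simp add: power_mult_distrib)
        then show ?thesis by (rule power2_le_imp_le) simp
      qed
      also have "cmod ?D \<le> \<kappa> / (4 * sqrt 2)"
        using DFT_le_norm[OF N \<mu>, of "\<lambda>t. complex_of_real (\<xi> t)"] that bound \<open>fourier_norm N \<xi> \<le> _\<close>
        unfolding fourier_norm_def by linarith
      finally have "linear_form N (\<lambda>t. \<kappa> * a \<mu> t) \<xi> \<le> \<kappa> * (sqrt 2 * (\<kappa> / (4 * sqrt 2)))"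
        using \<kappa>0 by (simp add: mult_left_mono)
      then show ?thesis by (simp add: power2_eq_square)
    qed
    then have "Z \<xi> \<le> (\<Sum>\<mu>\<in>?U. exp (\<kappa>\<^sup>2 / 4))" unfolding Z_def by (intro sum_mono)
    also have "\<dots> = real N * exp (\<kappa>\<^sup>2 / 4)" by (simp add: card_unity_roots[OF N])
    also have "\<dots> \<le> real N * (exp (\<kappa>\<^sup>2 / 2) / 2)"
    proof (intro mult_left_mono)
      have "ln (2 ^ 4) \<le> \<kappa>\<^sup>2" unfolding \<kappa>2 using big by (intro ln_mono) auto
      then have "4 * ln 2 \<le> \<kappa>\<^sup>2" by (subst (asm) ln_realpow) auto
      then have "exp (ln 2) \<le> exp (\<kappa>\<^sup>2 / 4)" by (intro exp_le_cancel_iff[THEN iffD2]) simp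
      then have "exp (\<kappa>\<^sup>2 / 4) * 2 \<le> exp (\<kappa>\<^sup>2 / 4) * exp (\<kappa>\<^sup>2 / 4)" by simp
      also have "\<dots> = exp (\<kappa>\<^sup>2 / 2)" by (simp flip: exp_add)
      finally show "exp (\<kappa>\<^sup>2 / 4) \<le> exp (\<kappa>\<^sup>2 / 2) / 2" by simp
    qed simp
    finally show ?thesis by (simp add: m_def)
  qed
  have "prob {\<xi> \<in> space (gauss_noise N). fourier_norm N \<xi> \<le> sqrt (ln (real N / \<alpha>)) / 40} \<le> prob (space (gauss_noise N) - ?A)"
  proof (rule finite_measure_mono)
    show "{\<xi> \<in> space (gauss_noise N). fourier_norm N \<xi> \<le> sqrt (ln (real N / \<alpha>)) / 40} \<subseteq> space (gauss_noise N) - ?A"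
      using small leD by blast
  qed simp
  also have "\<dots> = 1 - prob ?A" by (rule prob_compl) simp
  finally show ?thesis using prob by simp
qed

text \<open>When \<open>N/\<alpha>\<close> is bounded a constant lower bound suffices. By Fourier inversion \<open>\<bar>\<xi>\<^sub>0\<bar> \<le> sqrt N \<parallel>F\<^sub>N \<xi>\<parallel>\<^sub>\<infinity>\<close>,
  and the interval \<open>[-1/2, 1/2]\<close> has standard Gaussian measure at most \<open>1/2\<close>.\<close>

lemma small_ball_small_ratio:
  assumes N: "N \<ge> 1" and \<alpha>: "0 < \<alpha>" "\<alpha> < 1/2" and small: "real N / \<alpha> < 128"
  shows "measure (gauss_noise N) {\<xi> \<in> space (gauss_noise N). fourier_norm N \<xi> \<le> sqrt (ln (real N / \<alpha>)) / 40} < 1 - \<alpha>"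
proof -
  interpret prob_space "gauss_noise N" by (rule prob_space_gauss_noise)
  let ?s = "sqrt (ln (real N / \<alpha>)) / 40"
  have Na: "1 < real N / \<alpha>" using N \<alpha> by (simp add: field_simps)
  have "sqrt (real N) * ?s \<le> 1 / 2"
  proof -
    have "real N \<le> 64" using small \<alpha> by (simp add: field_simps)
    moreover have "ln (real N / \<alpha>) \<le> 6"
    proof -
      have "ln (real N / \<alpha>) \<le> ln (2 ^ 7)" using small Na by (intro ln_mono) auto
      also have "\<dots> = 7 * ln 2" by (subst ln_realpow) auto
      also have "\<dots> \<le> 7 * (25 / 36)" using ln2_le_25_over_36 by (intro mult_left_mono) auto
      finally show ?thesis by simp
    qed
    ultimately have "real N * ln (real N / \<alpha>) \<le> 64 * 6"
      using Na by (intro mult_mono) auto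
    then have "sqrt (real N * ln (real N / \<alpha>)) \<le> sqrt (20\<^sup>2)" by (intro real_sqrt_le_mono) simp
    then show ?thesis by (simp add: real_sqrt_mult)
  qed
  then have b: "sqrt (real N) * ?s \<le> 1 / 2" .
  have incl: "{\<xi> \<in> space (gauss_noise N). fourier_norm N \<xi> \<le> ?s} \<subseteq> {\<xi> \<in> space (gauss_noise N). \<xi> 0 \<in> {-1/2..1/2}}"
  proof
    fix \<xi> assume \<xi>: "\<xi> \<in> {\<xi> \<in> space (gauss_noise N). fourier_norm N \<xi> \<le> ?s}"
    have "\<bar>\<xi> 0\<bar> \<le> sqrt (real N) * fourier_norm N \<xi>"
      using value_bound_trivial[OF N, of 0 "\<lambda>t. complex_of_real (\<xi> t)"] N by (simp add: fourier_norm_def)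
    moreover have "sqrt (real N) * fourier_norm N \<xi> \<le> sqrt (real N) * ?s"
      using \<xi> by (intro mult_left_mono) auto
    ultimately have "\<bar>\<xi> 0\<bar> \<le> 1 / 2" using b by linarith
    then have "\<xi> 0 \<in> {-1/2..1/2}" unfolding atLeastAtMost_iff by linarith
    then show "\<xi> \<in> {\<xi> \<in> space (gauss_noise N). \<xi> 0 \<in> {-1/2..1/2}}" using \<xi> by blast
  qed
  have zero: "(0::nat) \<in> {..<N}" using N by simp
  have m0: "(\<lambda>\<xi>. \<xi> 0) \<in> gauss_noise N \<rightarrow>\<^sub>M std_normal_distribution"
    unfolding gauss_noise_def by (rule measurable_component_singleton) fact
  have "emeasure (gauss_noise N) {\<xi> \<in> space (gauss_noise N). \<xi> 0 \<in> {-1/2..1/2}}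
      = emeasure (distr (gauss_noise N) std_normal_distribution (\<lambda>\<xi>. \<xi> 0)) {-1/2..1/2}"
    by (subst emeasure_distr[OF m0]) (auto intro!: arg_cong2[of _ _ _ _ emeasure])
  also have "distr (gauss_noise N) std_normal_distribution (\<lambda>\<xi>. \<xi> 0) = std_normal_distribution"
    unfolding gauss_noise_def by (rule distr_PiM_component[OF prob_space_std_normal zero])
  also have "emeasure std_normal_distribution {-1/2..1/2}
      = (\<integral>\<^sup>+x. ennreal (std_normal_density x) * indicator {-1/2..1/2} x \<partial>lborel)"
    by (subst emeasure_density) auto
  also have "\<dots> \<le> (\<integral>\<^sup>+x. ennreal (1/2) * indicator {-1/2..1/2::real} x \<partial>lborel)"
  proof (intro nn_integral_mono mult_right_mono ennreal_leI)
    fix x :: real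
    have "sqrt (2 * pi) \<ge> sqrt (2\<^sup>2)" using pi_gt3 by (intro real_sqrt_le_mono) simp
    then have "1 / sqrt (2 * pi) \<le> 1 / 2" by (intro divide_left_mono) auto
    moreover have "exp (- x\<^sup>2 / 2) \<le> 1" by simp
    ultimately have "1 / sqrt (2 * pi) * exp (- x\<^sup>2 / 2) \<le> 1 / 2 * 1"
      by (intro mult_mono) auto
    then show "std_normal_density x \<le> 1 / 2" by (simp add: std_normal_density_def)
  qed simp
  also have "\<dots> = ennreal (1/2)"
    by (subst nn_integral_cmult_indicator) (auto simp flip: ennreal_mult)
  finally have "prob {\<xi> \<in> space (gauss_noise N). \<xi> 0 \<in> {-1/2..1/2}} \<le> 1/2"
    unfolding emeasure_eq_measure by (subst (asm) ennreal_le_iff) auto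
  moreover have "prob {\<xi> \<in> space (gauss_noise N). fourier_norm N \<xi> \<le> ?s}
      \<le> prob {\<xi> \<in> space (gauss_noise N). \<xi> 0 \<in> {-1/2..1/2}}"
  proof (rule finite_measure_mono[OF incl])
    have "(\<lambda>\<xi>. \<xi> 0) \<in> borel_measurable (gauss_noise N)" using m0 by simp
    then show "{\<xi> \<in> space (gauss_noise N). \<xi> 0 \<in> {-1/2..1/2}} \<in> sets (gauss_noise N)" by measurable
  qed
  ultimately show ?thesis using \<alpha> by simp
qed

lemma small_ball:
  assumes N: "N \<ge> 1" and \<alpha>: "0 < \<alpha>" "\<alpha> < 1/2"
  shows "measure (gauss_noise N) {\<xi> \<in> space (gauss_noise N). fourier_norm N \<xi> \<le> sqrt (ln (real N / \<alpha>)) / 40} < 1 - \<alpha>"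
  using small_ball_large_ratio[OF assms] small_ball_small_ratio[OF assms] by linarith

definition quantile_set :: "nat \<Rightarrow> real \<Rightarrow> real set" where
  "quantile_set N \<alpha> = {q. measure (gauss_noise N) {\<xi> \<in> space (gauss_noise N). fourier_norm N \<xi> \<le> q} \<ge> 1 - \<alpha>}"

lemma q_quantile_eq: "q_quantile N \<alpha> = Inf (quantile_set N \<alpha>)"
  by (simp add: q_quantile_def quantile_set_def fourier_norm_def)

lemma quantile_set_lower:
  assumes "N \<ge> 1" "0 < \<alpha>" "\<alpha> < 1/2" "q \<in> quantile_set N \<alpha>"
  shows "sqrt (ln (real N / \<alpha>)) / 40 \<le> q"
proof (rule ccontr)
  interpret prob_space "gauss_noise N" by (rule prob_space_gauss_noise)
  assume "\<not> ?thesis"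
  then have "prob {\<xi> \<in> space (gauss_noise N). fourier_norm N \<xi> \<le> q}
      \<le> prob {\<xi> \<in> space (gauss_noise N). fourier_norm N \<xi> \<le> sqrt (ln (real N / \<alpha>)) / 40}"
    using assms(1) by (intro finite_measure_mono) auto
  then show False using small_ball[OF assms(1-3)] assms(4) by (simp add: quantile_set_def)
qed

lemma quantile_set_upper:
  assumes N: "N \<ge> 1" and \<alpha>: "0 < \<alpha>" "\<alpha> < 1/2"
  shows "4 * sqrt (ln (real N / \<alpha>)) \<in> quantile_set N \<alpha>"
proof -
  interpret prob_space "gauss_noise N" by (rule prob_space_gauss_noise)
  let ?L = "ln (real N / \<alpha>)" and ?s = "4 * sqrt (ln (real N / \<alpha>))"
  have Na: "2 \<le> real N / \<alpha>" using N \<alpha> by (simp add: field_simps)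
  have L: "?L \<ge> 0" using Na by simp
  have "4 * real N * exp (- ?s\<^sup>2 / 4) \<le> \<alpha>"
  proof -
    have "exp (- ?s\<^sup>2 / 4) = exp (- (4 * ?L))" using L by (simp add: power_mult_distrib)
    also have "\<dots> = 1 / exp (real 4 * ?L)" by (simp add: exp_minus field_simps)
    also have "\<dots> = 1 / (real N / \<alpha>) ^ 4" using N \<alpha> by (subst exp_of_nat_mult) simp
    finally have "4 * real N * exp (- ?s\<^sup>2 / 4) = \<alpha> * (4 / (real N / \<alpha>) ^ 3)"
      using N \<alpha> by (simp add: field_simps power_numeral_reduce)
    also have "\<dots> \<le> \<alpha> * 1"
    proof (intro mult_left_mono)
      have "2 ^ 3 \<le> (real N / \<alpha>) ^ 3" using Na by (intro power_mono) auto
      moreover have "0 < (real N / \<alpha>) ^ 3" using Na by (intro zero_less_power) linarith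
      ultimately show "4 / (real N / \<alpha>) ^ 3 \<le> 1" by (subst divide_le_eq_1_pos) auto
    qed (use \<alpha> in simp)
    finally show ?thesis by simp
  qed
  then have "prob {\<xi> \<in> space (gauss_noise N). ?s < fourier_norm N \<xi>} \<le> \<alpha>"
    using fourier_norm_tail[OF N, of ?s] L by simp
  moreover have "prob {\<xi> \<in> space (gauss_noise N). \<not> (?s < fourier_norm N \<xi>)} = 1 - prob {\<xi> \<in> space (gauss_noise N). ?s < fourier_norm N \<xi>}"
    using N by (intro prob_neg) measurable
  ultimately show ?thesis by (simp add: quantile_set_def not_less)
qed

lemma q_quantile_bounds:
  assumes N: "N \<ge> 1" and \<alpha>: "0 < \<alpha>" "\<alpha> < 1/2"
  shows "sqrt (ln (real N / \<alpha>)) / 40 \<le> q_quantile N \<alpha>" "q_quantile N \<alpha> \<le> 4 * sqrt (ln (real N / \<alpha>))"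
    "0 < q_quantile N \<alpha>"
proof -
  show low: "sqrt (ln (real N / \<alpha>)) / 40 \<le> q_quantile N \<alpha>"
    unfolding q_quantile_eq using quantile_set_upper[OF assms] quantile_set_lower[OF assms]
    by (intro cInf_greatest) auto
  show "q_quantile N \<alpha> \<le> 4 * sqrt (ln (real N / \<alpha>))"
    unfolding q_quantile_eq using quantile_set_upper[OF assms] quantile_set_lower[OF assms]
    by (intro cInf_lower bdd_belowI[of _ "sqrt (ln (real N / \<alpha>)) / 40"]) auto
  have "1 < real N / \<alpha>" using N \<alpha> by (simp add: field_simps)
  then have "0 < sqrt (ln (real N / \<alpha>)) / 40" by simp
  with low show "0 < q_quantile N \<alpha>" by linarith
qed

text \<open>The infimum that defines the quantile is attained by continuity of the measure from below, so the tail bound holds at the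
  quantile itself.\<close>

lemma noise_exceeds_quantile:
  assumes N: "N \<ge> 1" and \<alpha>: "0 < \<alpha>" "\<alpha> < 1/2"
  shows "measure (gauss_noise N) {\<xi> \<in> space (gauss_noise N). q_quantile N \<alpha> < fourier_norm N \<xi>} \<le> \<alpha>"
proof -
  interpret prob_space "gauss_noise N" by (rule prob_space_gauss_noise)
  let ?q = "q_quantile N \<alpha>"
  define A where "A n = {\<xi> \<in> space (gauss_noise N). ?q + inverse (real (Suc n)) < fourier_norm N \<xi>}" for n
  have meas [measurable]: "fourier_norm N \<in> borel_measurable (gauss_noise N)"
    using fourier_norm_measurable[OF N] by simp
  have [measurable]: "A n \<in> sets (gauss_noise N)" for n unfolding A_def by measurable
  have le: "prob (A n) \<le> \<alpha>" for n
  proof -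
    have "Inf (quantile_set N \<alpha>) < ?q + inverse (real (Suc n))" by (simp add: q_quantile_eq)
    then obtain q where q: "q \<in> quantile_set N \<alpha>" "q < ?q + inverse (real (Suc n))"
      using quantile_set_upper[OF assms] cInf_lessD by blast
    have "prob (A n) \<le> prob {\<xi> \<in> space (gauss_noise N). \<not> (fourier_norm N \<xi> \<le> q)}"
      using q by (intro finite_measure_mono) (auto simp: A_def)
    also have "\<dots> = 1 - prob {\<xi> \<in> space (gauss_noise N). fourier_norm N \<xi> \<le> q}" by (intro prob_neg) measurable
    also have "\<dots> \<le> \<alpha>" using q by (simp add: quantile_set_def)
    finally show ?thesis .
  qed
  have "incseq A"
  proof (rule incseq_SucI, unfold A_def, clarify)
    fix n \<xi> assume "?q + inverse (real (Suc n)) < fourier_norm N \<xi>"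
    moreover have "inverse (real (Suc (Suc n))) \<le> inverse (real (Suc n))" by (intro le_imp_inverse_le) auto
    ultimately show "?q + inverse (real (Suc (Suc n))) < fourier_norm N \<xi>" by linarith
  qed
  then have "(\<lambda>n. prob (A n)) \<longlonglongrightarrow> prob (\<Union>n. A n)" by (intro finite_Lim_measure_incseq) auto
  then have "prob (\<Union>n. A n) \<le> \<alpha>" by (rule LIMSEQ_le_const2) (use le in auto)
  also have "(\<Union>n. A n) = {\<xi> \<in> space (gauss_noise N). ?q < fourier_norm N \<xi>}"
  proof (intro equalityI subsetI)
    fix \<xi> assume "\<xi> \<in> {\<xi> \<in> space (gauss_noise N). ?q < fourier_norm N \<xi>}"
    then obtain n where "inverse (real (Suc n)) < fourier_norm N \<xi> - ?q" "\<xi> \<in> space (gauss_noise N)"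
      using reals_Archimedean[of "fourier_norm N \<xi> - ?q"] by auto
    then show "\<xi> \<in> (\<Union>n. A n)" by (auto simp: A_def algebra_simps)
  next
    fix \<xi> assume "\<xi> \<in> (\<Union>n. A n)"
    then obtain n where "?q + inverse (real (Suc n)) < fourier_norm N \<xi>" "\<xi> \<in> space (gauss_noise N)"
      by (auto simp: A_def)
    moreover have "0 < inverse (real (Suc n))" by simp
    ultimately show "\<xi> \<in> {\<xi> \<in> space (gauss_noise N). ?q < fourier_norm N \<xi>}"
      by (intro CollectI conjI) (assumption, linarith)
  qed
  finally show ?thesis .
qed

section \<open>Measurability of the test statistic\<close>

lemma fourier_norm_triangle:
  assumes N: "N \<ge> 1"
  shows "fourier_norm N (\<lambda>t. u t + v t) \<le> fourier_norm N u + fourier_norm N v"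
  unfolding fourier_norm_def
proof (rule DFT_norm_le[OF N])
  fix \<mu> assume \<mu>: "\<mu> \<in> unity_roots N"
  have "DFT N (\<lambda>t. complex_of_real (u t + v t)) \<mu>
      = DFT N (\<lambda>t. complex_of_real (u t)) \<mu> + DFT N (\<lambda>t. complex_of_real (v t)) \<mu>"
    by (simp add: DFT_def sum.distrib distrib_left distrib_right)
  then show "cmod (DFT N (\<lambda>t. complex_of_real (u t + v t)) \<mu>)
      \<le> DFT_norm N (\<lambda>t. complex_of_real (u t)) + DFT_norm N (\<lambda>t. complex_of_real (v t))"
    using norm_triangle_ineq[of "DFT N (\<lambda>t. complex_of_real (u t)) \<mu>" "DFT N (\<lambda>t. complex_of_real (v t)) \<mu>"]
      DFT_le_norm[OF N \<mu>, of "\<lambda>t. complex_of_real (u t)"] DFT_le_norm[OF N \<mu>, of "\<lambda>t. complex_of_real (v t)"]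
    by simp
qed

lemma fourier_norm_cong: "(\<And>t. t < N \<Longrightarrow> u t = v t) \<Longrightarrow> fourier_norm N u = fourier_norm N v"
  by (simp add: fourier_norm_def DFT_norm_def DFT_def)

lemma fourier_norm_nonneg: "N \<ge> 1 \<Longrightarrow> 0 \<le> fourier_norm N u"
  unfolding fourier_norm_def by (rule DFT_norm_nonneg)

lemma fourier_norm_uminus: "fourier_norm N (\<lambda>t. - u t) = fourier_norm N u"
  by (simp add: fourier_norm_def DFT_norm_def DFT_def sum_negf norm_mult)

lemma fourier_norm_le_sum:
  assumes N: "N \<ge> 1"
  shows "fourier_norm N u \<le> (\<Sum>t<N. \<bar>u t\<bar>)"
  unfolding fourier_norm_def
proof (rule DFT_norm_le[OF N])
  fix \<mu> assume \<mu>: "\<mu> \<in> unity_roots N"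
  have "cmod (DFT N (\<lambda>t. complex_of_real (u t)) \<mu>) = real N powr (-1/2) * cmod (\<Sum>t<N. complex_of_real (u t) * \<mu> ^ t)"
    by (simp add: DFT_def norm_mult)
  also have "real N powr (-1/2) = 1 / sqrt (real N)" by (rule powr_minus_half(1)[OF N])
  finally have "cmod (DFT N (\<lambda>t. complex_of_real (u t)) \<mu>) = 1 / sqrt (real N) * cmod (\<Sum>t<N. complex_of_real (u t) * \<mu> ^ t)" .
  also have "\<dots> \<le> 1 * (\<Sum>t<N. \<bar>u t\<bar>)"
  proof (intro mult_mono)
    show "cmod (\<Sum>t<N. complex_of_real (u t) * \<mu> ^ t) \<le> (\<Sum>t<N. \<bar>u t\<bar>)"
      using norm_unity_root[OF N \<mu>] by (intro sum_norm_le) (simp add: norm_mult norm_power)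
  qed (use N in auto)
  finally show "cmod (DFT N (\<lambda>t. complex_of_real (u t)) \<mu>) \<le> (\<Sum>t<N. \<bar>u t\<bar>)" by simp
qed

lemma Opt_eq: "Opt N Z y = (INF v\<in>window N ` Z. fourier_norm N (\<lambda>t. y t - v t))"
  by (simp add: Opt_def fourier_norm_def image_image)

lemma Opt_bdd_below: "N \<ge> 1 \<Longrightarrow> bdd_below ((\<lambda>v. fourier_norm N (\<lambda>t. y t - v t)) ` W)"
  by (intro bdd_belowI[of _ 0]) (auto simp: fourier_norm_nonneg)

text \<open>The statistic is an infimum over an uncountable set. As the Fourier norm is continuous in finitely many coordinates,
  the infimum may be restricted to a countable set of nuisance windows that is dense for the product topology.\<close>

lemma Opt_measurable:
  assumes N: "N \<ge> 1"
  shows "Opt N Z \<in> borel_measurable (Rvec N)"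
proof -
  define W where "W = window N ` Z"
  define f where "f v y = fourier_norm N (\<lambda>t. y t - v t)" for v y :: "nat \<Rightarrow> real"
  obtain D where D: "countable D" "D \<subseteq> W" "W \<subseteq> closure D" using separable by blast
  have bdd: "bdd_below ((\<lambda>v. f v y) ` V)" for y V
    unfolding f_def by (rule Opt_bdd_below[OF N])
  have "(INF v\<in>W. f v y) = (INF v\<in>D. f v y)" for y
  proof (cases "W = {}")
    case True
    then show ?thesis using D by simp
  next
    case False
    then have "D \<noteq> {}" using D by auto
    show ?thesis
    proof (rule antisym)
      show "(INF v\<in>W. f v y) \<le> (INF v\<in>D. f v y)"
        using D \<open>D \<noteq> {}\<close> bdd by (intro cINF_superset_mono) auto
      show "(INF v\<in>D. f v y) \<le> (INF v\<in>W. f v y)"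
      proof (rule cINF_greatest[OF False])
        fix v assume "v \<in> W"
        then have v: "v \<in> closure D" using D by auto
        show "(INF v\<in>D. f v y) \<le> f v y"
        proof (rule field_le_epsilon)
          fix e :: real assume e: "e > 0"
          let ?O = "{v'. (\<Sum>t<N. \<bar>v t - v' t\<bar>) < e}"
          have "open ?O"
            by (intro open_Collect_less continuous_intros) auto
          moreover have "v \<in> ?O" using e by simp
          then have "?O \<inter> closure D \<noteq> {}" using v by blast
          ultimately have "?O \<inter> D \<noteq> {}" using open_Int_closure_eq_empty by blast
          then obtain v' where v': "v' \<in> D" "(\<Sum>t<N. \<bar>v t - v' t\<bar>) < e" by blast
          have "(INF v\<in>D. f v y) \<le> f v' y" using bdd v' by (intro cINF_lower)
          also have "f v' y \<le> f v y + fourier_norm N (\<lambda>t. v t - v' t)"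
            using fourier_norm_triangle[OF N, of "\<lambda>t. y t - v t" "\<lambda>t. v t - v' t"] by (simp add: f_def)
          also have "\<dots> \<le> f v y + e" using fourier_norm_le_sum[OF N, of "\<lambda>t. v t - v' t"] v' by simp
          finally show "(INF v\<in>D. f v y) \<le> f v y + e" .
        qed
      qed
    qed
  qed
  then have "Opt N Z = (\<lambda>y. INF v\<in>D. f v y)" by (intro ext) (simp only: Opt_eq W_def f_def)
  moreover have "(\<lambda>y. INF v\<in>D. f v y) \<in> borel_measurable (Rvec N)"
  proof (intro borel_measurable_cINF D bdd)
    fix v
    have "(\<lambda>y. \<lambda>t\<in>{..<N}. y t - v t) \<in> Rvec N \<rightarrow>\<^sub>M Rvec N"
      unfolding Rvec_def by measurable
    then have "(\<lambda>y. fourier_norm N (\<lambda>t\<in>{..<N}. y t - v t)) \<in> borel_measurable (Rvec N)"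
      by (rule measurable_compose[OF _ fourier_norm_measurable[OF N]])
    also have "(\<lambda>y. fourier_norm N (\<lambda>t\<in>{..<N}. y t - v t)) = (\<lambda>y. f v y)"
      unfolding f_def by (intro ext fourier_norm_cong) simp
    finally show "(\<lambda>y. f v y) \<in> borel_measurable (Rvec N)" .
  qed
  ultimately show ?thesis by simp
qed

section \<open>Risk of the basic test\<close>

lemma basic_test_is_test:
  assumes N: "N \<ge> 1"
  shows "is_test N (basic_test N \<alpha> Z)"
proof -
  have [measurable]: "Opt N Z \<in> borel_measurable (Rvec N)" by (rule Opt_measurable[OF N])
  show ?thesis unfolding is_test_def basic_test_def by measurable
qed

text \<open>On the event \<open>\<parallel>F\<^sub>N \<xi>\<parallel>\<^sub>\<infinity> \<le> q\<close> the statistic is at most \<open>q\<close> for a signal of \<open>H0\<close> and at least \<open>3 q - q = 2 q\<close> for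
  a signal of \<open>H1\<close>, and \<open>q\<close> is positive; so there is no error on this event.\<close>

lemma separated_basic_test_risk:
  assumes N: "N \<ge> 1" and \<alpha>: "0 < \<alpha>" "\<alpha> < 1/2"
    and Z: "Z \<noteq> {}" and H0: "H0 \<subseteq> Z"
    and sep: "\<And>x z. x \<in> H1 \<Longrightarrow> z \<in> Z \<Longrightarrow> 3 * q_quantile N \<alpha> \<le> fourier_norm N (\<lambda>t. x (int t) - z (int t))"
  shows "Risk N (basic_test N \<alpha> Z) H0 H1 \<le> ennreal \<alpha>"
proof -
  interpret prob_space "gauss_noise N" by (rule prob_space_gauss_noise)
  let ?q = "q_quantile N \<alpha>"
  let ?E = "{\<xi> \<in> space (gauss_noise N). ?q < fourier_norm N \<xi>}"
  define obs where "obs x \<xi> = (\<lambda>t\<in>{..<N}. window N x t + \<xi> t)" for x and \<xi> :: "nat \<Rightarrow> real"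
  have [measurable]: "Opt N Z \<in> borel_measurable (Rvec N)" by (rule Opt_measurable[OF N])
  have [measurable]: "obs x \<in> gauss_noise N \<rightarrow>\<^sub>M Rvec N" for x
  proof -
    have "obs x \<in> Rvec N \<rightarrow>\<^sub>M Rvec N" unfolding obs_def Rvec_def by measurable
    then show ?thesis by simp
  qed
  have meas_noise [measurable]: "fourier_norm N \<in> borel_measurable (gauss_noise N)"
    using fourier_norm_measurable[OF N] by simp
  have stat: "fourier_norm N (\<lambda>t. obs x \<xi> t - window N z t) = fourier_norm N (\<lambda>t. (x (int t) - z (int t)) + \<xi> t)" for x z \<xi>
    by (intro fourier_norm_cong) (simp add: obs_def window_def)
  have prob: "emeasure (obs_distr N x) {y \<in> space (Rvec N). basic_test N \<alpha> Z y = b} \<le> ennreal \<alpha>"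
    if imp: "\<And>\<xi>. fourier_norm N \<xi> \<le> ?q \<Longrightarrow> basic_test N \<alpha> Z (obs x \<xi>) \<noteq> b" for x b
  proof -
    have [measurable]: "{y \<in> space (Rvec N). basic_test N \<alpha> Z y = b} \<in> sets (Rvec N)"
      unfolding basic_test_def by measurable
    have "emeasure (obs_distr N x) {y \<in> space (Rvec N). basic_test N \<alpha> Z y = b}
        = emeasure (gauss_noise N) (obs x -` {y \<in> space (Rvec N). basic_test N \<alpha> Z y = b} \<inter> space (gauss_noise N))"
      unfolding obs_distr_def obs_def[symmetric] by (intro emeasure_distr) measurable
    also have "\<dots> \<le> emeasure (gauss_noise N) ?E"
      using imp by (intro emeasure_mono) (auto simp: not_le[symmetric])
    also have "\<dots> \<le> ennreal \<alpha>"
      unfolding emeasure_eq_measure by (intro ennreal_leI noise_exceeds_quantile N \<alpha>)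
    finally show ?thesis .
  qed
  have "err0 N (basic_test N \<alpha> Z) H0 \<le> ennreal \<alpha>"
    unfolding err0_def
  proof (intro SUP_least prob)
    fix x and \<xi> :: "nat \<Rightarrow> real" assume x: "x \<in> H0" and \<xi>: "fourier_norm N \<xi> \<le> ?q"
    have "Opt N Z (obs x \<xi>) \<le> fourier_norm N (\<lambda>t. obs x \<xi> t - window N x t)"
      unfolding Opt_eq using x H0 by (intro cINF_lower Opt_bdd_below[OF N]) auto
    also have "\<dots> = fourier_norm N \<xi>" by (simp add: stat)
    finally show "basic_test N \<alpha> Z (obs x \<xi>) \<noteq> 1" using \<xi> by (simp add: basic_test_def)
  qed
  moreover have "err1 N (basic_test N \<alpha> Z) H1 \<le> ennreal \<alpha>"
    unfolding err1_def
  proof (intro SUP_least prob)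
    fix x and \<xi> :: "nat \<Rightarrow> real" assume x: "x \<in> H1" and \<xi>: "fourier_norm N \<xi> \<le> ?q"
    have "2 * ?q \<le> Opt N Z (obs x \<xi>)"
      unfolding Opt_eq
    proof (rule cINF_greatest)
      fix v assume "v \<in> window N ` Z"
      then obtain z where z: "z \<in> Z" "v = window N z" by auto
      have "fourier_norm N (\<lambda>t. x (int t) - z (int t))
          \<le> fourier_norm N (\<lambda>t. (x (int t) - z (int t)) + \<xi> t) + fourier_norm N (\<lambda>t. - \<xi> t)"
        using fourier_norm_triangle[OF N, of "\<lambda>t. (x (int t) - z (int t)) + \<xi> t" "\<lambda>t. - \<xi> t"] by simp
      then show "2 * ?q \<le> fourier_norm N (\<lambda>t. obs x \<xi> t - v t)"
        using sep[OF x z(1)] \<xi> by (simp add: z(2) stat fourier_norm_uminus)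
    qed (use Z in simp)
    then show "basic_test N \<alpha> Z (obs x \<xi>) \<noteq> 0"
      using q_quantile_bounds(3)[OF N \<alpha>] by (simp add: basic_test_def)
  qed
  ultimately show ?thesis by (simp add: Risk_def)
qed

section \<open>Separation of the alternatives\<close>

definition frequency_roots :: "real multiset \<Rightarrow> complex multiset" where
  "frequency_roots w = image_mset (\<lambda>\<omega>. exp (\<i> * complex_of_real \<omega>)) w"

lemma frequency_roots_unit: "\<forall>z\<in>#frequency_roots w. cmod z = 1"
  by (auto simp: frequency_roots_def)

lemma shift_power: "(shift ^^ k) x t = x (t - int k)"
  by (induction k arbitrary: t) (simp_all add: shift_def algebra_simps)

lemma Sig_iff: "x \<in> Sig w \<longleftrightarrow> (\<lambda>t. complex_of_real (x t)) \<in> exp_sums (frequency_roots w)"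
proof -
  have "freq_poly w = root_poly (frequency_roots w)"
    by (simp add: freq_poly_def root_poly_def frequency_roots_def multiset.map_comp comp_def)
  then show ?thesis
    by (simp add: Sig_def exp_sums_def apply_shift_poly_def act_def shift_power)
qed

lemma Sig_zero: "(\<lambda>_. 0) \<in> Sig w"
  by (simp add: Sig_iff exp_sums_def)

text \<open>The nuisance components are annihilated by the polynomial of \<open>w\<close> and the signal by that of \<open>w'\<close>, so that the product
  annihilates all three terms.\<close>

lemma Sig_sum:
  assumes u: "u \<in> Sig w" and z: "z \<in> Sig w" and s: "s \<in> Sig w'"
  shows "(\<lambda>t. u t + s t - z t) \<in> Sig (w + w')"
proof -
  let ?P = "root_poly (frequency_roots (w + w'))"
  have P: "?P = root_poly (frequency_roots w) * root_poly (frequency_roots w')"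
    by (simp add: frequency_roots_def root_poly_def)
  have "act ?P (\<lambda>t. complex_of_real (u t + s t - z t)) t
      = act ?P (\<lambda>t. complex_of_real (u t)) t + act ?P (\<lambda>t. complex_of_real (s t)) t
        - act ?P (\<lambda>t. complex_of_real (z t)) t" for t
    by (simp add: act_def algebra_simps sum.distrib sum_subtractf)
  moreover have "act ?P (\<lambda>t. complex_of_real (u t)) t = 0" "act ?P (\<lambda>t. complex_of_real (z t)) t = 0"
    "act ?P (\<lambda>t. complex_of_real (s t)) t = 0" for t
    using u z s P by (auto simp: Sig_iff intro!: act_dvd)
  ultimately show ?thesis by (simp add: Sig_iff exp_sums_def)
qed

lemma sup_norm_nonneg: "N \<ge> 1 \<Longrightarrow> 0 \<le> sup_norm N f"
  unfolding sup_norm_def by (rule order.trans[OF abs_ge_zero[of "f 0"] Max_ge]) auto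

lemma Sig_sup_norm_bound:
  assumes d: "size w = d" "d \<ge> 1" and N: "N \<ge> 1" and x: "x \<in> Sig w"
  shows "sup_norm N (window N x)
    \<le> 828 * real d ^ 3 * ln (2 * real d) / sqrt (real N) * fourier_norm N (\<lambda>t. x (int t))"
proof -
  have "\<bar>window N x t\<bar> \<le> 828 * real d ^ 3 * ln (2 * real d) / sqrt (real N) * fourier_norm N (\<lambda>t. x (int t))"
    if "t < N" for t
    using exp_sums_uniform_bound[OF frequency_roots_unit _ d(2) N that, of w "\<lambda>t. complex_of_real (x t)"] x d that
    by (simp add: Sig_iff fourier_norm_def window_def frequency_roots_def)
  then show ?thesis
    unfolding sup_norm_def using N by (subst Max_le_iff) (auto simp: lessThan_empty_iff)
qed

text \<open>The constant \<open>2484\<close> is three times the constant of the uniform bound.\<close>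

lemma separation:
  assumes d: "size w = d" "d \<ge> 1" and N: "N \<ge> 1" and x: "x \<in> Sig w"
    and \<rho>: "2484 * rate_quantile N d \<alpha> \<le> \<rho>" "\<rho> \<le> sup_norm N (window N x)"
  shows "3 * q_quantile N \<alpha> \<le> fourier_norm N (\<lambda>t. x (int t))"
proof -
  define K where "K = 828 * real d ^ 3 * ln (2 * real d) / sqrt (real N)"
  have "K > 0" using d N ln_double_ge[OF d(2)] by (simp add: K_def)
  have "K * (3 * q_quantile N \<alpha>) = 2484 * rate_quantile N d \<alpha>"
    using N by (simp add: K_def rate_quantile_def powr_minus_half)
  also have "\<dots> \<le> K * fourier_norm N (\<lambda>t. x (int t))"
    using \<rho> Sig_sup_norm_bound[OF d N x] by (simp add: K_def)
  finally show ?thesis using \<open>K > 0\<close> by simp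
qed

lemma rates_comparable:
  assumes N: "N \<ge> 1" and d: "d \<ge> 1" and \<alpha>: "0 < \<alpha>" "\<alpha> < 1/2"
  shows "1 / 40 * rate_log N d \<alpha> \<le> rate_quantile N d \<alpha>" "rate_quantile N d \<alpha> \<le> 4 * rate_log N d \<alpha>"
proof -
  define K where "K = real d ^ 3 * ln (2 * real d) / sqrt (real N)"
  have K: "K \<ge> 0" using ln_double_ge[OF d] by (simp add: K_def)
  have q: "rate_quantile N d \<alpha> = K * q_quantile N \<alpha>"
    using N by (simp add: K_def rate_quantile_def powr_minus_half)
  have l: "rate_log N d \<alpha> = K * sqrt (ln (real N / \<alpha>))"
    by (simp add: K_def rate_log_def real_sqrt_mult real_sqrt_inverse divide_inverse)
  show "1 / 40 * rate_log N d \<alpha> \<le> rate_quantile N d \<alpha>"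
    using mult_left_mono[OF q_quantile_bounds(1)[OF N \<alpha>] K] by (simp add: q l)
  show "rate_quantile N d \<alpha> \<le> 4 * rate_log N d \<alpha>"
    using mult_left_mono[OF q_quantile_bounds(2)[OF N \<alpha>] K] by (simp add: q l)
qed

lemma basic_test_P2:
  assumes N: "N \<ge> 1" and ds: "ds \<ge> 1" and \<alpha>: "0 < \<alpha>" "\<alpha> < 1/2" and w: "w \<in> Freqs dn"
    and \<rho>: "2484 * rate_quantile N (dn + ds) \<alpha> \<le> \<rho>"
  shows "Risk N (basic_test N \<alpha> (Sig w)) (P2_H0 w) (P2_H1 N w ds \<rho>) \<le> ennreal \<alpha>"
proof (rule separated_basic_test_risk[OF N \<alpha>])
  show "Sig w \<noteq> {}" using Sig_zero by blast
  show "P2_H0 w \<subseteq> Sig w" by (simp add: P2_H0_def)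
  fix x z assume x: "x \<in> P2_H1 N w ds \<rho>" and z: "z \<in> Sig w"
  then obtain u s w' where u: "u \<in> Sig w" and w': "w' \<in> Freqs ds" and s: "s \<in> Sig w'"
    and xus: "x = (\<lambda>t. u t + s t)"
    by (auto simp: P2_H1_def Sig_dim_def)
  have "\<rho> \<le> (INF z\<in>Sig w. sup_norm N (window N (\<lambda>t. x t - z t)))" using x by (simp add: P2_H1_def)
  also have "\<dots> \<le> sup_norm N (window N (\<lambda>t. x t - z t))"
    using z by (intro cINF_lower bdd_belowI[of _ 0]) (auto intro: sup_norm_nonneg[OF N])
  finally have "\<rho> \<le> sup_norm N (window N (\<lambda>t. x t - z t))" .
  moreover have "(\<lambda>t. x t - z t) \<in> Sig (w + w')" using Sig_sum[OF u z s] by (simp add: xus)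
  moreover have "size (w + w') = dn + ds" using w w' by (simp add: Freqs_def)
  ultimately show "3 * q_quantile N \<alpha> \<le> fourier_norm N (\<lambda>t. x (int t) - z (int t))"
    using separation[of "w + w'" "dn + ds" N "\<lambda>t. x t - z t" \<alpha> \<rho>] \<rho> N ds by simp
qed

lemma basic_test_P1:
  assumes N: "N \<ge> 1" and ds: "ds \<ge> 1" and \<alpha>: "0 < \<alpha>" "\<alpha> < 1/2"
    and \<rho>: "2484 * rate_quantile N ds \<alpha> \<le> \<rho>"
  shows "Risk N (basic_test N \<alpha> {\<lambda>_. 0}) P1_H0 (P1_H1 N ds \<rho>) \<le> ennreal \<alpha>"
proof (rule separated_basic_test_risk[OF N \<alpha>])
  show "P1_H0 \<subseteq> {\<lambda>_. 0}" by (simp add: P1_H0_def)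
  fix x and z :: signal assume x: "x \<in> P1_H1 N ds \<rho>" and z: "z \<in> {\<lambda>_. 0}"
  then obtain w where "w \<in> Freqs ds" "x \<in> Sig w" "\<rho> \<le> sup_norm N (window N x)"
    by (auto simp: P1_H1_def Sig_dim_def)
  then show "3 * q_quantile N \<alpha> \<le> fourier_norm N (\<lambda>t. x (int t) - z (int t))"
    using separation[of w ds N x \<alpha> \<rho>] \<rho> N ds z by (simp add: Freqs_def)
qed simp

theorem theorem3p1:
  shows "(\<exists>C1>0. \<exists>C2>0. \<forall>(N::nat) (dn::nat) (ds::nat) (\<alpha>::real) (w::real multiset) (\<rho>::real).
            N \<ge> 1 \<longrightarrow> ds \<ge> 1 \<longrightarrow> 0 < \<alpha> \<longrightarrow> \<alpha> < 1/2 \<longrightarrow> w \<in> Freqs dn \<longrightarrow> \<rho> > 0 \<longrightarrow>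
            (\<rho> \<ge> C1 * rate_quantile N (dn + ds) \<alpha> \<or> \<rho> \<ge> C2 * rate_log N (dn + ds) \<alpha>) \<longrightarrow>
              (is_test N (basic_test N \<alpha> (Sig w)) \<and>
               Risk N (basic_test N \<alpha> (Sig w)) (P2_H0 w) (P2_H1 N w ds \<rho>) \<le> ennreal \<alpha>) \<and>
              (dn = 0 \<longrightarrow>
               is_test N (basic_test N \<alpha> {\<lambda>_. 0}) \<and>
               Risk N (basic_test N \<alpha> {\<lambda>_. 0}) P1_H0 (P1_H1 N ds \<rho>) \<le> ennreal \<alpha>))
       \<and> (\<exists>c>0. \<exists>C>0. \<forall>(N::nat) (d::nat) (\<alpha>::real).
            N \<ge> 1 \<longrightarrow> d \<ge> 1 \<longrightarrow> 0 < \<alpha> \<longrightarrow> \<alpha> < 1/2 \<longrightarrow>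
              c * rate_log N d \<alpha> \<le> rate_quantile N d \<alpha> \<and>
              rate_quantile N d \<alpha> \<le> C * rate_log N d \<alpha>)"
proof (intro conjI)
  have main: "(is_test N (basic_test N \<alpha> (Sig w)) \<and>
       Risk N (basic_test N \<alpha> (Sig w)) (P2_H0 w) (P2_H1 N w ds \<rho>) \<le> ennreal \<alpha>) \<and>
      (dn = 0 \<longrightarrow> is_test N (basic_test N \<alpha> {\<lambda>_. 0}) \<and>
       Risk N (basic_test N \<alpha> {\<lambda>_. 0}) P1_H0 (P1_H1 N ds \<rho>) \<le> ennreal \<alpha>)"
    if N: "N \<ge> 1" and ds: "ds \<ge> 1" and \<alpha>: "0 < \<alpha>" "\<alpha> < 1/2" and w: "w \<in> Freqs dn"
      and \<rho>: "\<rho> \<ge> 2484 * rate_quantile N (dn + ds) \<alpha> \<or> \<rho> \<ge> 9936 * rate_log N (dn + ds) \<alpha>"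
    for N dn ds :: nat and \<alpha> \<rho> :: real and w
  proof -
    \<comment> \<open>Here \<open>9936 = 4 * 2484\<close>, and \<open>4\<close> is the constant in the upper bound on the quantile.\<close>
    have "2484 * rate_quantile N (dn + ds) \<alpha> \<le> \<rho>"
      using \<rho> rates_comparable(2)[OF N _ \<alpha>, of "dn + ds"] ds by auto
    then show ?thesis
      using basic_test_P2[OF N ds \<alpha> w] basic_test_P1[OF N ds \<alpha>] basic_test_is_test[OF N] by auto
  qed
  show "\<exists>C1>0. \<exists>C2>0. \<forall>(N::nat) (dn::nat) (ds::nat) (\<alpha>::real) (w::real multiset) (\<rho>::real).
            N \<ge> 1 \<longrightarrow> ds \<ge> 1 \<longrightarrow> 0 < \<alpha> \<longrightarrow> \<alpha> < 1/2 \<longrightarrow> w \<in> Freqs dn \<longrightarrow> \<rho> > 0 \<longrightarrow>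
            (\<rho> \<ge> C1 * rate_quantile N (dn + ds) \<alpha> \<or> \<rho> \<ge> C2 * rate_log N (dn + ds) \<alpha>) \<longrightarrow>
              (is_test N (basic_test N \<alpha> (Sig w)) \<and>
               Risk N (basic_test N \<alpha> (Sig w)) (P2_H0 w) (P2_H1 N w ds \<rho>) \<le> ennreal \<alpha>) \<and>
              (dn = 0 \<longrightarrow>
               is_test N (basic_test N \<alpha> {\<lambda>_. 0}) \<and>
               Risk N (basic_test N \<alpha> {\<lambda>_. 0}) P1_H0 (P1_H1 N ds \<rho>) \<le> ennreal \<alpha>)"
    by (rule exI[of _ 2484], rule conjI, simp, rule exI[of _ 9936], rule conjI, simp, intro allI impI, rule main)
  show "\<exists>c>0. \<exists>C>0. \<forall>(N::nat) (d::nat) (\<alpha>::real).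
            N \<ge> 1 \<longrightarrow> d \<ge> 1 \<longrightarrow> 0 < \<alpha> \<longrightarrow> \<alpha> < 1/2 \<longrightarrow>
              c * rate_log N d \<alpha> \<le> rate_quantile N d \<alpha> \<and>
              rate_quantile N d \<alpha> \<le> C * rate_log N d \<alpha>"
    by (rule exI[of _ "1/40"], rule conjI, simp, rule exI[of _ 4], rule conjI, simp)
       (intro allI impI conjI rates_comparable)
qed

end
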